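(* Let $d\ge 1$, let $W$ be a finite dimensional complex Hilbert space, and let $U$ be a periodic unitary transition operator on $\ell^{2}(\mathbb{Z}^{d},W)$. Then $U$ has no eigenvalues if and only if $\limsup_{n\to\infty}p_{n}(u;x)=0$ for every $u\in\ell^{2}(\mathbb{Z}^{d},W)$ and every $x\in\mathbb{Z}^{d}$. Therefore, if $U$ has no eigenvalues, then there are no nonzero initial state $u$ and point $x$ such that the transition probability of $U$ with initial state $u$ is localized at $x$.
   Context: $\ell^{2}(\mathbb{Z}^{d},W)$ is the Hilbert space of square summable $W$-valued functions on $\mathbb{Z}^d$ with inner product $\langle f,g\rangle=\sum_{x}\langle f(x),g(x)\rangle_{W}$. For $y\in\mathbb{Z}^{d}$ and $\phi\in W$, $\delta_{y}\otimes\phi$ is the function with value $\phi$ at $y$ and $0$ elsewhere. A unitary operator $U$ on $\ell^{2}(\mathbb{Z}^{d},W)$ is a periodic unitary transition operator if (a) $U$ commutes with the natural action (by translations) of $\mathbb{Z}^{d}$, and (b) there is a finite set $S\subset\mathbb{Z}^{d}$ such that $U(\delta_{x}\otimes\phi)(y)=0$ for all $x\in\mathbb{Z}^{d}$, $y\in\mathbb{Z}^{d}\setminus(x+S)$, $\phi\in W$. The transition probability is $p_{n}(u;x)=\|(U^{n}u)(x)\|_{W}^{2}$ for integers $n\ge 0$. The transition probability of $U$ with initial state $u$ is said to be localized at $x$ if $\limsup_{n\to\infty}p_{n}(u;x)>0$. *)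

theory Defs
  imports "HOL-Analysis.Analysis"
begin

text \<open>
  Complex inner product spaces, presented on top of \<^class>\<open>real_inner\<close> so that the library's norm
  and topology are available. Since the real inner product is the real part of the complex one, the
  norm is \<open>\<parallel>x\<parallel> = sqrt (Re \<langle>x, x\<rangle>)\<close>, and positive definiteness is inherited from \<^class>\<open>real_inner\<close>.
\<close>

class complex_inner = real_inner +
  fixes scaleC :: "complex \<Rightarrow> 'a \<Rightarrow> 'a" (infixr "*\<^sub>C" 75)
    and cinner :: "'a \<Rightarrow> 'a \<Rightarrow> complex"
  assumes scaleC_add_right: "c *\<^sub>C (x + y) = c *\<^sub>C x + c *\<^sub>C y"
    and scaleC_add_left: "(b + c) *\<^sub>C x = b *\<^sub>C x + c *\<^sub>C x"
    and scaleC_scaleC: "b *\<^sub>C c *\<^sub>C x = (b * c) *\<^sub>C x"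
    and scaleC_one: "1 *\<^sub>C x = x"
    and scaleR_scaleC: "r *\<^sub>R x = complex_of_real r *\<^sub>C x"
    and cinner_add_left: "cinner (x + y) z = cinner x z + cinner y z"
    and cinner_scaleC_left: "cinner (c *\<^sub>C x) y = c * cinner x y"
    and cinner_commute: "cinner y x = cnj (cinner x y)"
    and inner_eq_Re_cinner: "inner x y = Re (cinner x y)"

text \<open>Completeness is automatic in finite dimension. The zero space is admitted.\<close>

class fin_dim_complex_hilbert = complex_inner +
  assumes finite_complex_spanning_set:
    "\<exists>B. finite B \<and> (\<forall>x. \<exists>c. x = (\<Sum>b\<in>B. c b *\<^sub>C b))"

instantiation complex :: fin_dim_complex_hilbert
begin

definition scaleC_complex :: "complex \<Rightarrow> complex \<Rightarrow> complex"
  where "scaleC_complex c x = c * x"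

definition cinner_complex :: "complex \<Rightarrow> complex \<Rightarrow> complex"
  where "cinner_complex x y = x * cnj y"

instance
proof
  show "\<exists>B. finite B \<and> (\<forall>x::complex. \<exists>c. x = (\<Sum>b\<in>B. c b *\<^sub>C b))"
    by (rule exI[of _ "{1}"]) (auto simp: scaleC_complex_def)
qed (simp_all add: scaleC_complex_def cinner_complex_def distrib_left distrib_right mult.assoc
      scaleR_conv_of_real inner_complex_def mult.commute)

end

instantiation vec :: (fin_dim_complex_hilbert, finite) fin_dim_complex_hilbert
begin

definition scaleC_vec :: "complex \<Rightarrow> 'a ^ 'b \<Rightarrow> 'a ^ 'b"
  where "scaleC_vec c x = (\<chi> i. c *\<^sub>C (x $ i))"

definition cinner_vec :: "'a ^ 'b \<Rightarrow> 'a ^ 'b \<Rightarrow> complex"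
  where "cinner_vec x y = (\<Sum>i\<in>UNIV. cinner (x $ i) (y $ i))"

instance
proof
  fix b c :: complex and r :: real and x y z :: "'a ^ 'b"
  show "c *\<^sub>C (x + y) = c *\<^sub>C x + c *\<^sub>C y"
    by (simp add: vec_eq_iff scaleC_vec_def scaleC_add_right)
  show "(b + c) *\<^sub>C x = b *\<^sub>C x + c *\<^sub>C x"
    by (simp add: vec_eq_iff scaleC_vec_def scaleC_add_left)
  show "b *\<^sub>C c *\<^sub>C x = (b * c) *\<^sub>C x"
    by (simp add: vec_eq_iff scaleC_vec_def scaleC_scaleC)
  show "1 *\<^sub>C x = x"
    by (simp add: vec_eq_iff scaleC_vec_def scaleC_one)
  show "r *\<^sub>R x = complex_of_real r *\<^sub>C x"
    by (simp add: vec_eq_iff scaleC_vec_def scaleR_scaleC)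
  show "cinner (x + y) z = cinner x z + cinner y z"
    by (simp add: cinner_vec_def cinner_add_left sum.distrib)
  show "cinner (c *\<^sub>C x) y = c * cinner x y"
    by (simp add: cinner_vec_def scaleC_vec_def cinner_scaleC_left sum_distrib_left)
  show "cinner y x = cnj (cinner x y)"
    unfolding cinner_vec_def cnj_sum by (rule sum.cong[OF refl]) (rule cinner_commute)
  show "inner x y = Re (cinner x y)"
    by (simp add: inner_vec_def cinner_vec_def inner_eq_Re_cinner)
next
  obtain B :: "'a set" where B: "finite B" "\<And>x. \<exists>c. x = (\<Sum>b\<in>B. c b *\<^sub>C b)"
    using finite_complex_spanning_set by blast
  define C :: "('a ^ 'b) set" where "C = (\<lambda>(i, b). axis i b) ` (UNIV \<times> (B - {0}))"
  have zero: "c *\<^sub>C (0::'a) = 0" for c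
    using scaleC_add_right[of c "0::'a" 0] by simp
  have inj: "inj_on (\<lambda>(i, b). axis i b :: 'a ^ 'b) (UNIV \<times> (B - {0}))"
    by (auto simp: inj_on_def axis_eq_axis)
  have "\<exists>c. x = (\<Sum>b\<in>C. c b *\<^sub>C b)" for x :: "'a ^ 'b"
  proof -
    obtain k where k: "\<And>i. x $ i = (\<Sum>b\<in>B. k i b *\<^sub>C b)"
    proof -
      have "\<exists>k. \<forall>i. x $ i = (\<Sum>b\<in>B. k i b *\<^sub>C b)"
        by (rule choice) (use B(2) in blast)
      then show thesis using that by blast
    qed
    define c where
      "c v = (case inv_into (UNIV \<times> (B - {0})) (\<lambda>(i, b). axis i b) v of (i, b) \<Rightarrow> k i b)"
      for v :: "'a ^ 'b"
    have c_axis: "c (axis i b) = k i b" if "b \<in> B" "b \<noteq> 0" for i b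
      using inv_into_f_f[OF inj, of "(i, b)"] that by (simp add: c_def)
    have "(\<Sum>v\<in>C. c v *\<^sub>C v) = (\<Sum>(i, b)\<in>UNIV \<times> (B - {0}). k i b *\<^sub>C axis i b)"
      unfolding C_def sum.reindex[OF inj]
      by (rule sum.cong[OF refl]) (simp add: c_axis split_beta mem_Times_iff)
    also have "\<dots> = (\<Sum>i\<in>UNIV. \<Sum>b\<in>B - {0}. k i b *\<^sub>C axis i b)"
      by (simp add: sum.cartesian_product)
    also have "\<dots> = x"
    proof (rule vec_eq_iff[THEN iffD2], rule allI)
      fix j
      have "(\<Sum>b\<in>B - {0}. k j b *\<^sub>C b) = x $ j"
        unfolding k[of j] by (rule sum.mono_neutral_left[OF B(1)]) (auto simp: zero)
      then have "(\<Sum>b\<in>B - {0}. (k i b *\<^sub>C axis i b :: 'a ^ 'b) $ j) = (if i = j then x $ j else 0)" for i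
        by (auto simp: scaleC_vec_def axis_def zero)
      then show "(\<Sum>i\<in>UNIV. \<Sum>b\<in>B - {0}. k i b *\<^sub>C axis i b) $ j = x $ j"
        by simp
    qed
    finally have "x = (\<Sum>b\<in>C. c b *\<^sub>C b)" by (rule sym)
    then show ?thesis by (rule exI[of _ c])
  qed
  then show "\<exists>B. finite B \<and> (\<forall>x::'a ^ 'b. \<exists>c. x = (\<Sum>b\<in>B. c b *\<^sub>C b))"
    using B(1) by (intro exI[of _ C]) (auto simp: C_def)
qed

end

text \<open>
  The lattice is \<^typ>\<open>int ^ 'd\<close> with \<open>d = CARD('d) \<ge> 1\<close>. Elements of the Hilbert space are functions
  in the carrier set \<open>ell2\<close>; operators are HOL functions whose behaviour outside \<open>ell2\<close> is irrelevant.
\<close>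

definition ell2 :: "(int ^ 'd \<Rightarrow> 'w::fin_dim_complex_hilbert) set"
  where "ell2 = {f. (\<lambda>x. (norm (f x))\<^sup>2) summable_on UNIV}"

definition ell2_inner ::
    "(int ^ 'd \<Rightarrow> 'w::fin_dim_complex_hilbert) \<Rightarrow> (int ^ 'd \<Rightarrow> 'w) \<Rightarrow> complex"
  where "ell2_inner f g = (\<Sum>\<^sub>\<infinity>x. cinner (f x) (g x))"

definition delta_tensor :: "int ^ 'd \<Rightarrow> 'w::fin_dim_complex_hilbert \<Rightarrow> (int ^ 'd \<Rightarrow> 'w)"
  where "delta_tensor y \<phi> = (\<lambda>x. if x = y then \<phi> else 0)"

definition translate :: "int ^ 'd \<Rightarrow> (int ^ 'd \<Rightarrow> 'w::fin_dim_complex_hilbert) \<Rightarrow> (int ^ 'd \<Rightarrow> 'w)"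
  where "translate a f = (\<lambda>x. f (x - a))"

definition linear_ell2 ::
    "((int ^ 'd \<Rightarrow> 'w::fin_dim_complex_hilbert) \<Rightarrow> (int ^ 'd \<Rightarrow> 'w)) \<Rightarrow> bool"
  where "linear_ell2 U \<longleftrightarrow>
    (\<forall>f\<in>ell2. \<forall>g\<in>ell2. U (\<lambda>x. f x + g x) = (\<lambda>x. U f x + U g x)) \<and>
    (\<forall>c. \<forall>f\<in>ell2. U (\<lambda>x. c *\<^sub>C f x) = (\<lambda>x. c *\<^sub>C U f x))"

definition unitary_ell2 ::
    "((int ^ 'd \<Rightarrow> 'w::fin_dim_complex_hilbert) \<Rightarrow> (int ^ 'd \<Rightarrow> 'w)) \<Rightarrow> bool"
  where "unitary_ell2 U \<longleftrightarrow>
    linear_ell2 U \<and> U ` ell2 = ell2 \<and>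
    (\<forall>f\<in>ell2. \<forall>g\<in>ell2. ell2_inner (U f) (U g) = ell2_inner f g)"

definition periodic_unitary_transition_operator ::
    "((int ^ 'd \<Rightarrow> 'w::fin_dim_complex_hilbert) \<Rightarrow> (int ^ 'd \<Rightarrow> 'w)) \<Rightarrow> bool"
  where "periodic_unitary_transition_operator U \<longleftrightarrow>
    unitary_ell2 U \<and>
    (\<forall>a. \<forall>f\<in>ell2. U (translate a f) = translate a (U f)) \<and>
    (\<exists>S. finite S \<and> (\<forall>x y \<phi>. y \<notin> (\<lambda>s. x + s) ` S \<longrightarrow> U (delta_tensor x \<phi>) y = 0))"

definition eigenvalue_ell2 ::
    "((int ^ 'd \<Rightarrow> 'w::fin_dim_complex_hilbert) \<Rightarrow> (int ^ 'd \<Rightarrow> 'w)) \<Rightarrow> complex \<Rightarrow> bool"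
  where "eigenvalue_ell2 U c \<longleftrightarrow>
    (\<exists>f\<in>ell2. f \<noteq> (\<lambda>x. 0) \<and> U f = (\<lambda>x. c *\<^sub>C f x))"

definition transition_prob ::
    "((int ^ 'd \<Rightarrow> 'w::fin_dim_complex_hilbert) \<Rightarrow> (int ^ 'd \<Rightarrow> 'w)) \<Rightarrow>
      nat \<Rightarrow> (int ^ 'd \<Rightarrow> 'w) \<Rightarrow> int ^ 'd \<Rightarrow> real"
  where "transition_prob U n u x = (norm ((U ^^ n) u x))\<^sup>2"

text \<open>The limit superior is taken in \<^typ>\<open>ereal\<close>, where it always exists.\<close>

definition localized_at ::
    "((int ^ 'd \<Rightarrow> 'w::fin_dim_complex_hilbert) \<Rightarrow> (int ^ 'd \<Rightarrow> 'w)) \<Rightarrow>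
      (int ^ 'd \<Rightarrow> 'w) \<Rightarrow> int ^ 'd \<Rightarrow> bool"
  where "localized_at U u x \<longleftrightarrow> limsup (\<lambda>n. ereal (transition_prob U n u x)) > 0"

end

theory Submission
  imports Defs "HOL-Complex_Analysis.Great_Picard" "HOL-Computational_Algebra.Fundamental_Theorem_Algebra"
begin

text \<open>
  Let \<open>X\<^sub>j\<close> be the \<open>j\<close>-th position operator and \<open>D\<^sub>j = [X\<^sub>j, U]\<close>, which is bounded since \<open>U\<close> has finite
  range. The mean \<open>A\<^sub>j n\<close> of the operators \<open>U\<^sup>k (D\<^sub>j U\<^sup>-\<^sup>1) U\<^sup>-\<^sup>k\<close> over \<open>k < n\<close> equals \<open>[X\<^sub>j, U\<^sup>n] U\<^sup>-\<^sup>n / n\<close>.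
  Conjugation by \<open>U\<close> preserves the trace per unit volume, so by the mean ergodic theorem \<open>A\<^sub>j n\<close>
  converges strongly to an asymptotic velocity. The matrix elements of \<open>[X\<^sub>j, U\<^sup>n]\<close> between fixed
  sites are bounded in \<open>n\<close>; hence every weak limit point of an orbit \<open>U\<^sup>n \<delta>\<^sub>z\<close> lies in the space \<open>H\<^sub>0\<close> of
  states of zero velocity.

  If \<open>H\<^sub>0 \<noteq> 0\<close>, then \<open>U\<close> has an eigenvalue. Counting dimensions, \<open>U\<close> satisfies a nontrivial polynomial
  relation \<open>p(U) = 0\<close> with coefficients in the group ring of the translations. The relations valid on
  \<open>H\<^sub>0\<close> are closed under the derivations \<open>T\<^sub>a \<mapsto> a\<^sub>j T\<^sub>a\<close> of the coefficients: for \<open>v, f \<in> H\<^sub>0\<close> the matrix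
  element \<open>\<langle>v, [X\<^sub>j, p(U)] f\<rangle>\<close> vanishes, and averaging over conjugation by \<open>U\<close> removes the terms in
  which \<open>U\<close> is differentiated. Applying derivations until a single translation is left yields a
  scalar polynomial in \<open>U\<close> annihilating \<open>H\<^sub>0\<close>, and its linear factors produce an eigenvector.
\<close>

section \<open>Square summable functions as an inner product space\<close>

lemma summable_on_norm_square_add:
  fixes f g :: "'i \<Rightarrow> 'w::real_inner"
  assumes "(\<lambda>x. (norm (f x))\<^sup>2) summable_on UNIV" "(\<lambda>x. (norm (g x))\<^sup>2) summable_on UNIV"
  shows "(\<lambda>x. (norm (f x + g x))\<^sup>2) summable_on UNIV"
proof (rule summable_on_comparison_test)
  show "(\<lambda>x. 2 * (norm (f x))\<^sup>2 + 2 * (norm (g x))\<^sup>2) summable_on UNIV"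
    by (intro summable_on_add summable_on_cmult_right assms)
  have "(norm (f x + g x))\<^sup>2 + (norm (f x - g x))\<^sup>2 = 2 * (norm (f x))\<^sup>2 + 2 * (norm (g x))\<^sup>2" for x
    by (simp add: power2_norm_eq_inner inner_add_left inner_add_right inner_diff_left inner_diff_right)
  then show "(norm (f x + g x))\<^sup>2 \<le> 2 * (norm (f x))\<^sup>2 + 2 * (norm (g x))\<^sup>2" for x
    by (metis le_add_same_cancel1 zero_le_power2)
qed auto

lemma summable_on_norm_square_scaleR:
  fixes f :: "'i \<Rightarrow> 'w::real_normed_vector"
  assumes "(\<lambda>x. (norm (f x))\<^sup>2) summable_on UNIV"
  shows "(\<lambda>x. (norm (r *\<^sub>R f x))\<^sup>2) summable_on UNIV"
  using summable_on_cmult_right[OF assms, of "r\<^sup>2"] by (simp add: power_mult_distrib)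

text \<open>Polarisation writes the inner product as a combination of summable squared
  norms.\<close>

lemma summable_on_inner:
  fixes f g :: "'i \<Rightarrow> 'w::real_inner"
  assumes "(\<lambda>x. (norm (f x))\<^sup>2) summable_on UNIV" "(\<lambda>x. (norm (g x))\<^sup>2) summable_on UNIV"
  shows "(\<lambda>x. inner (f x) (g x)) summable_on UNIV"
proof -
  have "(\<lambda>x. (1/2) * ((norm (f x + g x))\<^sup>2 + ((-1) * (norm (f x))\<^sup>2 + (-1) * (norm (g x))\<^sup>2))) summable_on UNIV"
    by (intro summable_on_add summable_on_cmult_right summable_on_norm_square_add assms)
  also have "(\<lambda>x. (1/2) * ((norm (f x + g x))\<^sup>2 + ((-1) * (norm (f x))\<^sup>2 + (-1) * (norm (g x))\<^sup>2)))
      = (\<lambda>x. inner (f x) (g x))"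
    by (auto simp: power2_norm_eq_inner inner_add_left inner_add_right inner_commute)
  finally show ?thesis .
qed

text \<open>A type, rather than the carrier set \<open>ell2\<close>, makes the class
  \<open>real_inner\<close> and bounded operators available. The fibre is an arbitrary
  \<open>real_inner\<close> type, so that \<open>l2\<close> can itself serve as a fibre in
  \<open>hs\<close>.\<close>

typedef (overloaded) ('i, 'w) l2 = "{f :: 'i \<Rightarrow> 'w::real_inner. (\<lambda>x. (norm (f x))\<^sup>2) summable_on UNIV}"
  morphisms coord Abs_l2
  by (rule exI[of _ "\<lambda>_. 0"]) simp

lemma summable_coord: "(\<lambda>x. (norm (coord f x))\<^sup>2) summable_on UNIV"
  using coord[of f] by simp

lemma coord_Abs_l2:
  "(\<lambda>x. (norm (f x))\<^sup>2) summable_on UNIV \<Longrightarrow> coord (Abs_l2 f) = f"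
  by (simp add: Abs_l2_inverse)

lemma l2_eqI: "(\<And>x. coord f x = coord g x) \<Longrightarrow> f = g"
  by (metis coord_inject ext)

instantiation l2 :: (type, real_inner) real_inner
begin

definition "0 = Abs_l2 (\<lambda>_. 0)"
definition "f + g = Abs_l2 (\<lambda>x. coord f x + coord g x)"
definition "- f = Abs_l2 (\<lambda>x. (-1) *\<^sub>R coord f x)"
definition "f - g = f + (- g :: ('a, 'b) l2)"
definition "r *\<^sub>R f = Abs_l2 (\<lambda>x. r *\<^sub>R coord f x)"
definition "inner f g = (\<Sum>\<^sub>\<infinity>x. inner (coord f x) (coord g x))"
definition "norm f = sqrt (inner f (f :: ('a, 'b) l2))"
definition "sgn f = inverse (norm f) *\<^sub>R (f :: ('a, 'b) l2)"
definition "dist f g = norm (f - g :: ('a, 'b) l2)"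
definition "(uniformity :: (('a, 'b) l2 \<times> ('a, 'b) l2) filter) =
  (INF e\<in>{0 <..}. principal {(x, y). dist x y < e})"
definition "open (U :: ('a, 'b) l2 set) \<longleftrightarrow> (\<forall>x\<in>U. \<forall>\<^sub>F (x', y) in uniformity. x' = x \<longrightarrow> y \<in> U)"

lemma coord_simps:
  "coord 0 x = 0"
  "coord (f + g) x = coord f x + coord g x"
  "coord (- f) x = - coord f x"
  "coord (f - g) x = coord f x - coord g x"
  "coord (r *\<^sub>R f) x = r *\<^sub>R coord f x"
  for f g :: "('a, 'b) l2"
proof -
  show *: "coord 0 x = 0" "coord (f + g) x = coord f x + coord g x" "coord (- f) x = - coord f x"
    "coord (r *\<^sub>R f) x = r *\<^sub>R coord f x" for f g :: "('a, 'b) l2"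
    unfolding zero_l2_def plus_l2_def uminus_l2_def scaleR_l2_def
    using coord_Abs_l2[OF summable_on_norm_square_add[OF summable_coord[of f] summable_coord[of g]]]
      coord_Abs_l2[OF summable_on_norm_square_scaleR[OF summable_coord[of f]]]
      coord_Abs_l2[OF summable_on_norm_square_scaleR[OF summable_coord[of f], of "-1"]]
      coord_Abs_l2[of "\<lambda>_ :: 'a. 0 :: 'b"]
    by simp_all
  show "coord (f - g) x = coord f x - coord g x"
    by (simp add: minus_l2_def *)
qed

instance
proof
  fix f g h :: "('a, 'b) l2" and a b :: real
  show "f + g + h = f + (g + h)" "f + g = g + f" "0 + f = f" "- f + f = 0" "f - g = f + - g"
    "a *\<^sub>R (f + g) = a *\<^sub>R f + a *\<^sub>R g" "(a + b) *\<^sub>R f = a *\<^sub>R f + b *\<^sub>R f"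
    "a *\<^sub>R b *\<^sub>R f = (a * b) *\<^sub>R f" "1 *\<^sub>R f = f"
    by (rule l2_eqI; simp add: coord_simps algebra_simps)+
  show "inner f g = inner g f"
    by (simp add: inner_l2_def inner_commute)
  show "inner (f + g) h = inner f h + inner g h"
    unfolding inner_l2_def coord_simps inner_add_left
    by (rule infsum_add; intro summable_on_inner summable_coord)
  show "inner (a *\<^sub>R f) g = a * inner f g"
    unfolding inner_l2_def coord_simps by (simp add: infsum_cmult_right')
  show "0 \<le> inner f f"
    unfolding inner_l2_def by (rule infsum_nonneg) simp
  show "(inner f f = 0) = (f = 0)"
  proof
    assume "inner f f = 0"
    then have "inner (coord f x) (coord f x) = 0" for x
      unfolding inner_l2_def
      by (rule nonneg_infsum_le_0D[where A=UNIV, OF eq_refl]) (auto intro: summable_on_inner summable_coord)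
    then show "f = 0" by (auto intro!: l2_eqI simp: coord_simps)
  qed (simp add: inner_l2_def coord_simps)
qed (simp_all add: norm_l2_def sgn_l2_def dist_l2_def uniformity_l2_def open_l2_def)

end

declare coord_simps [simp]

lemma coord_sum [simp]: "coord (\<Sum>i\<in>A. f i) x = (\<Sum>i\<in>A. coord (f i) x)"
  by (induction A rule: infinite_finite_induct) auto

lemma norm_square_l2: "(norm f)\<^sup>2 = (\<Sum>\<^sub>\<infinity>x. (norm (coord f x))\<^sup>2)"
  by (simp add: power2_norm_eq_inner inner_l2_def)

lemma has_sum_norm_square_l2: "((\<lambda>x. (norm (coord f x))\<^sup>2) has_sum (norm f)\<^sup>2) UNIV"
  by (simp add: norm_square_l2 summable_coord)

lemma norm_coord_le: "norm (coord f x) \<le> norm f"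
proof -
  have "(norm (coord f x))\<^sup>2 \<le> (norm f)\<^sup>2"
    using finite_sum_le_infsum[OF summable_coord, of "{x}" f] by (simp add: norm_square_l2)
  then show ?thesis by simp
qed

lemma l2_boundedI:
  fixes f :: "'i \<Rightarrow> 'w::real_inner"
  assumes "\<And>F. finite F \<Longrightarrow> (\<Sum>x\<in>F. (norm (f x))\<^sup>2) \<le> C"
  shows "coord (Abs_l2 f) = f"
  by (rule coord_Abs_l2, rule nonneg_bdd_above_summable_on) (auto intro!: bdd_aboveI2 assms)

definition single :: "'i \<Rightarrow> 'w \<Rightarrow> ('i, 'w::real_inner) l2"
  where "single x w = Abs_l2 (\<lambda>y. if y = x then w else 0)"

lemma coord_single [simp]: "coord (single x w) y = (if y = x then w else 0)"
proof -
  have "(\<lambda>y. (norm (if y = x then w else 0))\<^sup>2) summable_on UNIV"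
    using summable_on_cong_neutral[of "{x}" UNIV "\<lambda>_. (norm w)\<^sup>2" "\<lambda>y. (norm (if y = x then w else 0))\<^sup>2"]
    by auto
  from coord_Abs_l2[OF this] show ?thesis by (simp add: single_def)
qed

lemma inner_single_right [simp]: "inner f (single x w) = inner (coord f x) w"
proof -
  have "(\<Sum>\<^sub>\<infinity>y. inner (coord f y) (coord (single x w) y)) = (\<Sum>\<^sub>\<infinity>y\<in>{x}. inner (coord f y) w)"
    by (rule infsum_cong_neutral) auto
  then show ?thesis by (simp add: inner_l2_def)
qed

lemma inner_single_left [simp]: "inner (single x w) f = inner w (coord f x)"
  by (metis inner_commute inner_single_right)

lemma norm_single [simp]: "norm (single x w) = norm w"
  by (simp add: norm_eq_sqrt_inner)

lemma single_add: "single x (v + w) = single x v + single x w"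
  and single_scaleR: "single x (r *\<^sub>R v) = r *\<^sub>R single x v"
  by (rule l2_eqI; simp)+

lemma single_sum: "single x (\<Sum>i\<in>A. f i) = (\<Sum>i\<in>A. single x (f i))"
  by (rule l2_eqI) simp

text \<open>Truncation to finitely many sites is an orthogonal projection, so the squared error is a
  tail of the series for the squared norm.\<close>

lemma singles_dense:
  fixes f :: "('i, 'w::real_inner) l2"
  assumes "e > 0"
  obtains F where "finite F" "norm (f - (\<Sum>x\<in>F. single x (coord f x))) < e"
proof -
  have "e\<^sup>2 / 2 > 0" using assms by simp
  from has_sum_finite_approximation[OF has_sum_norm_square_l2[of f] this]
  obtain F where F: "finite F"
    and d: "dist (\<Sum>x\<in>F. (norm (coord f x))\<^sup>2) ((norm f)\<^sup>2) \<le> e\<^sup>2 / 2"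
    by auto
  define g where "g = (\<Sum>x\<in>F. single x (coord f x))"
  have g1: "inner f g = (\<Sum>x\<in>F. (norm (coord f x))\<^sup>2)"
    by (simp add: g_def inner_sum_right power2_norm_eq_inner)
  have "coord g x = coord f x" if "x \<in> F" for x
    using that F by (simp add: g_def)
  then have g2: "inner g g = (\<Sum>x\<in>F. (norm (coord f x))\<^sup>2)"
    by (subst (2) g_def) (simp add: inner_sum_right power2_norm_eq_inner)
  have "(norm (f - g))\<^sup>2 = (norm f)\<^sup>2 - (\<Sum>x\<in>F. (norm (coord f x))\<^sup>2)"
    using g1 g2 by (simp add: power2_norm_eq_inner inner_diff_left inner_diff_right inner_commute)
  also have "\<dots> < e\<^sup>2"
    using d \<open>e\<^sup>2 / 2 > 0\<close> unfolding dist_real_def by linarith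
  finally have "norm (f - g) < e"
    using assms power_less_imp_less_base by fastforce
  with F show ?thesis by (intro that) (auto simp: g_def)
qed

text \<open>Equicontinuity: uniformly bounded functionals that tend to 0 on a total set tend to 0
  everywhere. The weak limits below are reduced in this way to vectors supported at one
  site.\<close>

lemma tendsto_0_if_singles:
  fixes \<phi> :: "nat \<Rightarrow> ('i, 'w::real_inner) l2 \<Rightarrow> real"
  assumes lin: "\<And>n. linear (\<phi> n)"
    and bound: "\<And>n f. \<bar>\<phi> n f\<bar> \<le> C * norm f"
    and singles: "\<And>x w. (\<lambda>n. \<phi> n (single x w)) \<longlonglongrightarrow> 0"
  shows "(\<lambda>n. \<phi> n f) \<longlonglongrightarrow> 0"
proof (rule LIMSEQ_I)
  fix r :: real assume "r > 0"
  \<comment> \<open>\<open>C\<close> need not be positive; \<open>C'\<close> is, and can be divided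
    by.\<close>
  define C' where "C' = \<bar>C\<bar> + 1"
  have C': "C' > 0" "\<bar>\<phi> n f\<bar> \<le> C' * norm f" for n f
    using order_trans[OF bound[of n f] mult_right_mono[of C C' "norm f"]] by (auto simp: C'_def)
  obtain F where F: "finite F" "norm (f - (\<Sum>x\<in>F. single x (coord f x))) < r / (2 * C')"
    using singles_dense[of "r / (2 * C')" f] \<open>r > 0\<close> C'(1) by auto
  define g where "g = (\<Sum>x\<in>F. single x (coord f x))"
  have "(\<lambda>n. \<phi> n g) = (\<lambda>n. \<Sum>x\<in>F. \<phi> n (single x (coord f x)))"
    by (simp add: g_def linear_sum[OF lin])
  moreover have "(\<lambda>n. \<Sum>x\<in>F. \<phi> n (single x (coord f x))) \<longlonglongrightarrow> (\<Sum>x\<in>F. 0)"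
    by (intro tendsto_sum singles)
  ultimately have "(\<lambda>n. \<phi> n g) \<longlonglongrightarrow> 0" by simp
  then obtain N where N: "\<And>n. n \<ge> N \<Longrightarrow> \<bar>\<phi> n g\<bar> < r / 2"
    using LIMSEQ_D[of "\<lambda>n. \<phi> n g" 0 "r / 2"] \<open>r > 0\<close> by auto
  have "norm (\<phi> n f - 0) < r" if "n \<ge> N" for n
  proof -
    have "C' * norm (f - g) < r / 2"
      using F(2) C'(1) by (simp add: g_def field_simps)
    then have "\<bar>\<phi> n (f - g)\<bar> < r / 2" using C'(2)[of n "f - g"] by simp
    moreover have "\<phi> n f = \<phi> n (f - g) + \<phi> n g"
      by (simp add: linear_diff[OF lin])
    ultimately show ?thesis using N[OF that] by simp
  qed
  then show "\<exists>N. \<forall>n\<ge>N. norm (\<phi> n f - 0) < r" by blast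
qed

section \<open>Multiplication operators, fibre maps and translations\<close>

lemma coord_pointwise:
  assumes "\<And>x w. norm (g x w) \<le> C * norm w"
  shows "coord (Abs_l2 (\<lambda>x. g x (coord f x))) = (\<lambda>x. g x (coord f x))"
proof (rule coord_Abs_l2, rule summable_on_comparison_test)
  show "(\<lambda>x. C\<^sup>2 * (norm (coord f x))\<^sup>2) summable_on UNIV"
    by (intro summable_on_cmult_right summable_coord)
  show "(norm (g x (coord f x)))\<^sup>2 \<le> C\<^sup>2 * (norm (coord f x))\<^sup>2" for x
    using power_mono[OF assms[of x "coord f x"] norm_ge_zero, where n=2] by (simp add: power_mult_distrib)
qed auto

lemma norm_l2_le:
  assumes "\<And>x. norm (coord f x) \<le> C * norm (coord g x)" "C \<ge> 0"
  shows "norm f \<le> C * norm g"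
proof -
  have "(norm f)\<^sup>2 \<le> (C * norm g)\<^sup>2"
    unfolding norm_square_l2 power_mult_distrib infsum_cmult_right'[symmetric]
    using assms(1) power_mono[OF assms(1) norm_ge_zero, where n=2]
    by (intro infsum_mono summable_coord summable_on_cmult_right) (auto simp: power_mult_distrib)
  then show ?thesis using assms(2) by (simp add: power2_le_iff_abs_le)
qed

text \<open>\<open>Blinfun\<close> yields the intended operator for bounded \<open>a\<close>, which
  is the hypothesis of \<open>coord_mult_op\<close>.\<close>

definition mult_op :: "('i \<Rightarrow> real) \<Rightarrow> ('i, 'w) l2 \<Rightarrow>\<^sub>L ('i, 'w::real_inner) l2"
  where "mult_op a = Blinfun (\<lambda>f. Abs_l2 (\<lambda>x. a x *\<^sub>R coord f x))"

lemma coord_mult_op: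
  fixes f :: "('i, 'w::real_inner) l2"
  assumes "\<And>x. \<bar>a x\<bar> \<le> C"
  shows "coord (mult_op a f) x = a x *\<^sub>R coord f x"
proof -
  have c: "coord (Abs_l2 (\<lambda>x. a x *\<^sub>R coord f x)) = (\<lambda>x. a x *\<^sub>R coord f x)" for f :: "('i, 'w::real_inner) l2"
    by (rule coord_pointwise[where g="\<lambda>x w. a x *\<^sub>R w" and C=C])
      (auto intro!: mult_right_mono assms)
  have "C \<ge> 0" using assms[of undefined] by linarith
  have "bounded_linear (\<lambda>f :: ('i, 'w::real_inner) l2. Abs_l2 (\<lambda>x. a x *\<^sub>R coord f x))"
  proof (rule bounded_linear_intro[where K=C])
    show "norm (Abs_l2 (\<lambda>x. a x *\<^sub>R coord f x)) \<le> norm f * C" for f :: "('i, 'w) l2"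
      using norm_l2_le[of "Abs_l2 (\<lambda>x. a x *\<^sub>R coord f x)" C f] assms \<open>C \<ge> 0\<close>
      by (simp add: c mult.commute mult_right_mono)
  qed (rule l2_eqI, simp only: c, simp add: c algebra_simps)+
  then show ?thesis by (simp add: mult_op_def bounded_linear_Blinfun_apply c)
qed

definition fibre_op :: "('w \<Rightarrow>\<^sub>L 'w) \<Rightarrow> ('i, 'w) l2 \<Rightarrow>\<^sub>L ('i, 'w::real_inner) l2"
  where "fibre_op g = Blinfun (\<lambda>f. Abs_l2 (\<lambda>x. g (coord f x)))"

lemma coord_fibre_op [simp]:
  fixes f :: "('i, 'w::real_inner) l2"
  shows "coord (fibre_op g f) x = g (coord f x)"
proof -
  have c: "coord (Abs_l2 (\<lambda>x. g (coord f x))) = (\<lambda>x. g (coord f x))" for f :: "('i, 'w) l2"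
    by (rule coord_pointwise[where g="\<lambda>x w. g w" and C="norm g"]) (rule norm_blinfun)
  have "bounded_linear (\<lambda>f :: ('i, 'w::real_inner) l2. Abs_l2 (\<lambda>x. g (coord f x)))"
  proof (rule bounded_linear_intro[where K="norm g"])
    show "norm (Abs_l2 (\<lambda>x. g (coord f x))) \<le> norm f * norm g" for f :: "('i, 'w) l2"
      using norm_l2_le[of "Abs_l2 (\<lambda>x. g (coord f x))" "norm g" f]
      by (simp add: c mult.commute norm_blinfun)
  qed (rule l2_eqI, simp only: c, simp add: c blinfun.add_right blinfun.scaleR_right)+
  then show ?thesis by (simp add: fibre_op_def bounded_linear_Blinfun_apply c)
qed

definition shift :: "'g::ab_group_add \<Rightarrow> ('g, 'w) l2 \<Rightarrow>\<^sub>L ('g, 'w::real_inner) l2"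
  where "shift a = Blinfun (\<lambda>f. Abs_l2 (\<lambda>x. coord f (x - a)))"

lemma bij_minus: "bij (\<lambda>x::'g::ab_group_add. x - a)"
  by (rule bij_betw_byWitness[where f'="\<lambda>x. x + a"]) auto

lemma coord_shift [simp]:
  fixes f :: "('a::ab_group_add, 'b::real_inner) l2"
  shows "coord (shift a f) x = coord f (x - a)"
proof -
  have "(\<lambda>x. (norm (coord f (x - a)))\<^sup>2) summable_on UNIV" for f :: "('a, 'b) l2"
    using summable_coord[of f] summable_on_reindex_bij_betw[OF bij_minus, of "\<lambda>x. (norm (coord f x))\<^sup>2" a]
    by simp
  then have c: "coord (Abs_l2 (\<lambda>x. coord f (x - a))) = (\<lambda>x. coord f (x - a))" for f :: "('a, 'b) l2"
    by (rule coord_Abs_l2)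
  have "(norm (Abs_l2 (\<lambda>x. coord f (x - a))))\<^sup>2 = (norm f)\<^sup>2" for f :: "('a, 'b) l2"
    unfolding norm_square_l2 c
    using infsum_reindex_bij_betw[OF bij_minus, of "\<lambda>x. (norm (coord f x))\<^sup>2" a] by simp
  then have n: "norm (Abs_l2 (\<lambda>x. coord f (x - a))) = norm f" for f :: "('a, 'b) l2"
    by simp
  have "bounded_linear (\<lambda>f :: ('a, 'b) l2. Abs_l2 (\<lambda>x. coord f (x - a)))"
    proof (rule bounded_linear_intro[where K=1])
    show "norm (Abs_l2 (\<lambda>x. coord f (x - a))) \<le> norm f * 1" for f :: "('a, 'b) l2"
      by (simp add: n)
  qed (rule l2_eqI, simp only: c, simp add: c)+
  then show ?thesis by (simp add: shift_def bounded_linear_Blinfun_apply c)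
qed

lemma shift_single [simp]: "shift a (single x w) = single (x + a) w"
  by (rule l2_eqI) (auto simp: algebra_simps)

lemma shift_shift [simp]: "shift a (shift b f) = shift (a + b) f"
  by (rule l2_eqI) (simp add: algebra_simps)

lemma shift_0 [simp]: "shift 0 f = f"
  by (rule l2_eqI) simp

lemma inner_shift_left: "inner (shift a f) g = inner f (shift (- a) g)"
  unfolding inner_l2_def
  using infsum_reindex_bij_betw[OF bij_minus, of "\<lambda>x. inner (coord f x) (coord g (x + a))" a] by simp

lemma norm_shift [simp]: "norm (shift a f) = norm f"
  by (simp add: norm_eq_sqrt_inner inner_shift_left)

section \<open>Frames, weak compactness and the mean ergodic theorem\<close>

text \<open>A Parseval frame: the reconstruction property of an orthonormal basis is all that is
  asked. Finite dimension of the fibre enters the analysis through such a set.\<close>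

definition tight_frame :: "'w::real_inner set \<Rightarrow> bool"
  where "tight_frame E \<longleftrightarrow> finite E \<and> (\<forall>w. (\<Sum>e\<in>E. inner w e *\<^sub>R e) = w)"

lemma tight_frame_inner:
  assumes "tight_frame E"
  shows "inner v w = (\<Sum>e\<in>E. inner v e * inner w e)"
proof -
  have "inner v w = inner (\<Sum>e\<in>E. inner v e *\<^sub>R e) w"
    using assms by (simp add: tight_frame_def)
  then show ?thesis by (simp only: inner_sum_left inner_scaleR_left inner_commute[of w])
qed

lemma tight_frame_exists:
  assumes "finite B" "span B = (UNIV :: 'w::real_inner set)"
  shows "\<exists>E :: 'w set. tight_frame E"
proof -
  obtain C :: "'w set" where C: "finite C" "span C = UNIV" "pairwise orthogonal C"
    using basis_orthogonal[OF assms(1)] assms(2) by auto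
  define C' where "C' = C - {0}"
  define n where "n c = (1 / norm c) *\<^sub>R c" for c :: 'w
  have orth: "inner c d = 0" if "c \<in> C'" "d \<in> C'" "c \<noteq> d" for c d
    using C(3) that by (auto simp: pairwise_def orthogonal_def C'_def)
  have finC': "finite C'" using C(1) by (simp add: C'_def)
  \<comment> \<open>Distinct orthogonal nonzero vectors stay distinct after normalisation, so sums
    over the image of \<open>n\<close> can be reindexed.\<close>
  have inj: "inj_on n C'"
  proof (rule inj_onI, rule ccontr)
    fix c d assume *: "c \<in> C'" "d \<in> C'" "n c = n d" "c \<noteq> d"
    then have "inner c d = 0" by (intro orth)
    then have "inner (n c) (n d) = 0" by (simp add: n_def)
    with * have "inner (n d) (n d) = 0" by simp
    with *(2) show False by (simp add: n_def C'_def)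
  qed
  have "(\<Sum>c\<in>C'. inner w (n c) *\<^sub>R n c) = w" for w
  proof -
    have "w \<in> span C'" using C(2) by (simp add: C'_def)
    then show ?thesis
    proof (induction rule: span_induct_alt)
      case base
      show ?case by simp
    next
      case (step r d w)
      have "(\<Sum>c\<in>C'. inner d (n c) *\<^sub>R n c) = (\<Sum>c\<in>{d}. inner d (n c) *\<^sub>R n c)"
        using step(1) by (intro sum.mono_neutral_right finC') (auto simp: n_def orth)
      also have "\<dots> = d"
        using step(1) by (auto simp: n_def C'_def simp flip: power2_norm_eq_inner power2_eq_square)
      finally have "(\<Sum>c\<in>C'. inner d (n c) *\<^sub>R n c) = d" .
      with step(2) show ?case
        by (simp add: inner_add_left scaleR_add_left sum.distrib scaleR_sum_right[symmetric]
            flip: scaleR_scaleR)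
    qed
  qed
  then have "tight_frame (n ` C')"
    using finC' by (simp add: tight_frame_def sum.reindex[OF inj])
  then show ?thesis ..
qed

text \<open>A complex spanning set together with its multiples by \<open>\<i>\<close> spans over the
  reals.\<close>

lemma span_fin_dim_complex_hilbert:
  "\<exists>B. finite B \<and> span B = (UNIV :: 'w::fin_dim_complex_hilbert set)"
proof -
  obtain B :: "'w set" where B: "finite B" "\<And>x. \<exists>c. x = (\<Sum>b\<in>B. c b *\<^sub>C b)"
    using finite_complex_spanning_set by blast
  define B' where "B' = B \<union> (\<lambda>b. \<i> *\<^sub>C b) ` B"
  have "c *\<^sub>C b \<in> span B'" if "b \<in> B" for c b
  proof -
    have "c *\<^sub>C b = (complex_of_real (Re c) + complex_of_real (Im c) * \<i>) *\<^sub>C b"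
      by (metis complex_eq mult.commute)
    also have "\<dots> = Re c *\<^sub>R b + Im c *\<^sub>R (\<i> *\<^sub>C b)"
      by (simp only: scaleR_scaleC scaleC_scaleC scaleC_add_left)
    also have "\<dots> \<in> span B'"
      using that by (intro span_add span_scale span_base) (auto simp: B'_def)
    finally show ?thesis .
  qed
  then have "x \<in> span B'" for x
    using B(2)[of x] by (auto intro!: span_sum)
  with B(1) show ?thesis
    by (intro exI[of _ B']) (auto simp: B'_def)
qed

text \<open>A diagonal argument makes every frame coefficient at every site converge. The pointwise
  limit is square summable because the bound passes to the limit on finite sets of sites, and
  convergence at single sites extends to all \<open>v\<close> by density.\<close>

lemma weakly_convergent_subsequence:
  fixes g :: "nat \<Rightarrow> ('i::countable, 'w::real_inner) l2"
  assumes E: "tight_frame (E :: 'w set)" and bound: "\<And>m. norm (g m) \<le> C"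
  obtains r f where "strict_mono r" "\<And>v. (\<lambda>k. inner v (g (r k))) \<longlonglongrightarrow> inner v f"
proof -
  have C: "C \<ge> 0" using order_trans[OF norm_ge_zero bound] .
  have "countable ((UNIV :: 'i set) \<times> E)"
    using E by (auto simp: tight_frame_def intro: countable_finite)
  moreover have "norm (inner (coord (g m) (fst p)) (snd p)) \<le> C * (\<Sum>e\<in>E. norm e)"
    if "p \<in> UNIV \<times> E" for m p
  proof -
    have "norm (snd p) \<le> (\<Sum>e\<in>E. norm e)"
      using that E by (intro member_le_sum) (auto simp: tight_frame_def)
    moreover have "norm (coord (g m) (fst p)) \<le> C"
      using norm_coord_le bound by (rule order_trans)
    ultimately have "norm (coord (g m) (fst p)) * norm (snd p) \<le> C * (\<Sum>e\<in>E. norm e)"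
      using C by (intro mult_mono) auto
    then show ?thesis
      using Cauchy_Schwarz_ineq2[of "coord (g m) (fst p)" "snd p"] by simp
  qed
  ultimately obtain r :: "nat \<Rightarrow> nat" where r: "strict_mono r"
    and conv: "\<And>p. p \<in> UNIV \<times> E \<Longrightarrow> \<exists>l. (\<lambda>k. inner (coord (g (r k)) (fst p)) (snd p)) \<longlonglongrightarrow> l"
    using function_convergent_subsequence[of "UNIV \<times> E" "\<lambda>m p. inner (coord (g m) (fst p)) (snd p)"]
    by metis
  define h where "h x = (\<Sum>e\<in>E. lim (\<lambda>k. inner (coord (g (r k)) x) e) *\<^sub>R e)" for x
  have h: "(\<lambda>k. coord (g (r k)) x) \<longlonglongrightarrow> h x" for x
  proof -
    have "(\<lambda>k. inner (coord (g (r k)) x) e) \<longlonglongrightarrow> lim (\<lambda>k. inner (coord (g (r k)) x) e)" if "e \<in> E" for e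
      using conv[of "(x, e)"] that by (auto simp: convergent_LIMSEQ_iff[symmetric] convergent_def)
    then have "(\<lambda>k. \<Sum>e\<in>E. inner (coord (g (r k)) x) e *\<^sub>R e) \<longlonglongrightarrow> h x"
      unfolding h_def by (intro tendsto_sum tendsto_scaleR tendsto_const)
    then show ?thesis using E by (simp add: tight_frame_def)
  qed
  have hb: "(\<Sum>x\<in>F. (norm (h x))\<^sup>2) \<le> C\<^sup>2" if "finite F" for F
  proof (rule LIMSEQ_le_const2)
    show "(\<lambda>k. \<Sum>x\<in>F. (norm (coord (g (r k)) x))\<^sup>2) \<longlonglongrightarrow> (\<Sum>x\<in>F. (norm (h x))\<^sup>2)"
      by (intro tendsto_intros h)
    have "(\<Sum>x\<in>F. (norm (coord f x))\<^sup>2) \<le> (norm f)\<^sup>2" for f :: "('i, 'w) l2"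
      unfolding norm_square_l2 by (rule finite_sum_le_infsum) (auto simp: that summable_coord)
    then show "\<exists>N. \<forall>n\<ge>N. (\<Sum>x\<in>F. (norm (coord (g (r n)) x))\<^sup>2) \<le> C\<^sup>2"
      using power_mono[OF bound norm_ge_zero, where n=2] order_trans by blast
  qed
  define f where "f = Abs_l2 h"
  have f: "coord f x = h x" for x
    unfolding f_def by (subst l2_boundedI[of h "C\<^sup>2"]) (auto intro: hb)
  have "(\<lambda>k. inner v (g (r k) - f)) \<longlonglongrightarrow> 0" for v
  proof (rule tendsto_0_if_singles[where \<phi>="\<lambda>k v. inner v (g (r k) - f)" and C="C + norm f"])
    show "linear (\<lambda>v. inner v (g (r k) - f))" for k
      by (intro linearI) (simp_all add: inner_add_left)
    show "\<bar>inner v (g (r k) - f)\<bar> \<le> (C + norm f) * norm v" for k v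
    proof -
      have "norm (g (r k) - f) \<le> C + norm f"
        using norm_triangle_ineq4[of "g (r k)" f] bound[of "r k"] by linarith
      then show ?thesis
        using Cauchy_Schwarz_ineq2[of v "g (r k) - f"] mult_left_mono[of "norm (g (r k) - f)" "C + norm f" "norm v"]
        by (simp add: mult.commute)
    qed
    show "(\<lambda>k. inner (single x w) (g (r k) - f)) \<longlonglongrightarrow> 0" for x w
      using tendsto_inner[OF tendsto_const h, of w x, THEN LIM_zero]
      by (simp add: f inner_diff_right)
  qed
  then have "(\<lambda>k. inner v (g (r k))) \<longlonglongrightarrow> inner v f" for v
    by (simp add: inner_diff_right LIM_zero_cancel)
  with r show thesis by (rule that)
qed

text \<open>The averages asymptotically minimise the norm among convex combinations of the
  \<open>x k\<close>, and the parallelogram law makes such a sequence Cauchy. Stationary inner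
  products take the place of an isometry sending \<open>x k\<close> to
  \<open>x (Suc k)\<close>.\<close>

lemma mean_ergodic_Cauchy:
  fixes x :: "nat \<Rightarrow> 'a::real_inner"
  assumes stationary: "\<And>k l. inner (x (Suc k)) (x (Suc l)) = inner (x k) (x l)"
  shows "Cauchy (\<lambda>n. (1 / real n) *\<^sub>R (\<Sum>k<n. x k))"
proof -
  define a where "a n = (1 / real n) *\<^sub>R (\<Sum>k<n. x k)" for n
  define M where "M = norm (x 0)"
  have inner_shift: "inner (x (k + j)) (x (l + j)) = inner (x k) (x l)" for k l j
    by (induction j) (simp_all add: stationary)
  have norm_x: "norm (x k) = M" for k
    using inner_shift[of 0 k 0] by (simp add: norm_eq_sqrt_inner M_def)
  have norm_shift: "norm (\<Sum>k<n. c k *\<^sub>R x (k + j)) = norm (\<Sum>k<n. c k *\<^sub>R x k)" for n c j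
    by (simp add: norm_eq_sqrt_inner inner_sum_left inner_sum_right inner_shift)
  \<comment> \<open>Moving the window of summation by one changes the sum by two terms of norm
    \<open>M\<close>.\<close>
  have drift: "norm ((\<Sum>j<N. x (k + j)) - (\<Sum>j<N. x j)) \<le> 2 * real k * M" for k N
  proof (induction k)
    case (Suc k)
    have "(\<Sum>j<N. x (Suc k + j)) = (\<Sum>j<N. x (k + j)) + (x (k + N) - x k)"
    proof (induction N)
      case (Suc N)
      then show ?case by simp
    qed simp
    then have "(\<Sum>j<N. x (Suc k + j)) - (\<Sum>j<N. x j) =
        ((\<Sum>j<N. x (k + j)) - (\<Sum>j<N. x j)) + (x (k + N) - x k)"
      by (simp only: diff_add_eq)
    then have "norm ((\<Sum>j<N. x (Suc k + j)) - (\<Sum>j<N. x j)) \<le>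
        norm ((\<Sum>j<N. x (k + j)) - (\<Sum>j<N. x j)) + norm (x (k + N) - x k)"
      by (simp only: norm_triangle_ineq)
    also have "norm (x (k + N) - x k) \<le> M + M"
      using norm_triangle_ineq4[of "x (k + N)" "x k"] by (simp add: norm_x)
    finally show ?case using Suc by (simp add: algebra_simps)
  qed (simp add: M_def)
  \<comment> \<open>Averaging the \<open>N\<close> translates of a convex combination gives
    \<open>a N\<close> up to the drift, and translates have equal norm. Hence for large
    \<open>N\<close> the norm of \<open>a N\<close> is nearly bounded by that of any fixed convex
    combination.\<close>
  have main: "norm (a N) \<le> norm (\<Sum>k<n. c k *\<^sub>R x k) + 2 * real n * M / real N"
    if "N > 0" "\<And>k. c k \<ge> 0" "(\<Sum>k<n. c k) = 1" for N n c
  proof -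
    have "real N *\<^sub>R a N = (\<Sum>j<N. x j)" using that(1) by (simp add: a_def)
    also have "\<dots> = (\<Sum>k<n. c k) *\<^sub>R (\<Sum>j<N. x j)" by (simp add: that(3))
    also have "\<dots> = (\<Sum>k<n. c k *\<^sub>R (\<Sum>j<N. x j))" by (rule scaleR_left.sum)
    also have "\<dots> = (\<Sum>j<N. \<Sum>k<n. c k *\<^sub>R x (k + j))
        - (\<Sum>k<n. c k *\<^sub>R ((\<Sum>j<N. x (k + j)) - (\<Sum>j<N. x j)))"
      by (subst sum.swap) (simp add: scaleR_right_diff_distrib sum_subtractf scaleR_sum_right)
    finally have "norm (real N *\<^sub>R a N) \<le> norm (\<Sum>j<N. \<Sum>k<n. c k *\<^sub>R x (k + j))
        + norm (\<Sum>k<n. c k *\<^sub>R ((\<Sum>j<N. x (k + j)) - (\<Sum>j<N. x j)))"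
      by (simp only: norm_triangle_ineq4)
    also have "norm (\<Sum>j<N. \<Sum>k<n. c k *\<^sub>R x (k + j)) \<le> real N * norm (\<Sum>k<n. c k *\<^sub>R x k)"
      using sum_norm_le[of "{..<N}" "\<lambda>j. \<Sum>k<n. c k *\<^sub>R x (k + j)" "\<lambda>_. norm (\<Sum>k<n. c k *\<^sub>R x k)"]
      by (simp add: norm_shift)
    also have "norm (\<Sum>k<n. c k *\<^sub>R ((\<Sum>j<N. x (k + j)) - (\<Sum>j<N. x j))) \<le> (\<Sum>k<n. c k * (2 * real n * M))"
    proof (rule sum_norm_le)
      fix k assume "k \<in> {..<n}"
      then have "2 * real k * M \<le> 2 * real n * M" by (intro mult_right_mono) (auto simp: M_def)
      with drift[of k N] show "norm (c k *\<^sub>R ((\<Sum>j<N. x (k + j)) - (\<Sum>j<N. x j))) \<le> c k * (2 * real n * M)"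
        using that(2)[of k] by (simp add: mult_left_mono)
    qed
    also have "\<dots> = 2 * real n * M" by (simp add: that(3) flip: sum_distrib_right)
    finally show ?thesis using that(1) by (simp add: field_simps)
  qed
  \<comment> \<open>The infimum starts at 1, since \<open>a 0\<close> is 0 by the convention for
    division by zero.\<close>
  define m where "m = (INF n\<in>{1..}. norm (a n))"
  have bdd: "bdd_below ((\<lambda>n. norm (a n)) ` {1..})" by (intro bdd_belowI[of _ 0]) auto
  have m_le: "m \<le> norm (\<Sum>k<n. c k *\<^sub>R x k)" if "\<And>k. c k \<ge> 0" "(\<Sum>k<n. c k) = 1" for n c
  proof (rule LIMSEQ_le_const)
    show "(\<lambda>N. norm (\<Sum>k<n. c k *\<^sub>R x k) + 2 * real n * M / real N) \<longlonglongrightarrow> norm (\<Sum>k<n. c k *\<^sub>R x k)"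
      using tendsto_add[OF tendsto_const lim_const_over_n[of "2 * real n * M"]] by simp
    show "\<exists>N. \<forall>k\<ge>N. m \<le> norm (\<Sum>k<n. c k *\<^sub>R x k) + 2 * real n * M / real k"
    proof (intro exI[of _ 1] allI impI)
      fix N :: nat assume "N \<ge> 1"
      then have "m \<le> norm (a N)" unfolding m_def by (intro cINF_lower bdd) auto
      then show "m \<le> norm (\<Sum>k<n. c k *\<^sub>R x k) + 2 * real n * M / real N"
        using main[OF _ that, of N] \<open>N \<ge> 1\<close> by simp
    qed
  qed
  \<comment> \<open>The weights of the average \<open>a n\<close>, padded by zeros so that averages
    of different lengths can be mixed.\<close>
  define p where "p n k = (if k < n then 1 / real n else 0)" for n k :: nat
  have p_nonneg: "p n k \<ge> 0" for n k
    by (simp add: p_def)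
  have a_coef: "a n = (\<Sum>k<l. p n k *\<^sub>R x k)" if "n \<le> l" for n l
  proof -
    have "(\<Sum>k<l. p n k *\<^sub>R x k) = (\<Sum>k<n. p n k *\<^sub>R x k)"
      using that by (intro sum.mono_neutral_right) (auto simp: p_def)
    then show ?thesis by (simp add: a_def p_def scaleR_sum_right)
  qed
  have coef_sum: "(\<Sum>k<l. p n k) = 1" if "n \<le> l" "n > 0" for n l
  proof -
    have "(\<Sum>k<l. p n k) = (\<Sum>k<n. p n k)"
      using that by (intro sum.mono_neutral_right) (auto simp: p_def)
    then show ?thesis using that by (simp add: p_def)
  qed
  have m_nonneg: "m \<ge> 0" unfolding m_def by (intro cINF_greatest) auto
  have upper: "\<exists>N0>0. \<forall>N\<ge>N0. norm (a N) < m + \<epsilon>" if "\<epsilon> > 0" for \<epsilon>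
  proof -
    obtain n where n: "n \<ge> 1" "norm (a n) < m + \<epsilon> / 2"
      using cINF_less_iff[OF _ bdd, of "m + \<epsilon> / 2"] \<open>\<epsilon> > 0\<close> unfolding m_def[symmetric] by auto
    have "(\<lambda>N. 2 * real n * M / real N) \<longlonglongrightarrow> 0" by (rule lim_const_over_n)
    then obtain N0 where N0: "\<And>N. N \<ge> N0 \<Longrightarrow> \<bar>2 * real n * M / real N\<bar> < \<epsilon> / 2"
      using LIMSEQ_D[of _ 0 "\<epsilon> / 2"] \<open>\<epsilon> > 0\<close> by (metis diff_zero half_gt_zero real_norm_def)
    have "norm (a N) < m + \<epsilon>" if "N \<ge> Suc N0" for N
    proof -
      have "norm (a N) \<le> norm (a n) + 2 * real n * M / real N"
        using main[of N "p n" n] that n(1) coef_sum[of n n] a_coef[of n n] p_nonneg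
        by simp
      then show ?thesis using n(2) N0[OF Suc_leD[OF that]] by linarith
    qed
    then show ?thesis by blast
  qed
  show "Cauchy (\<lambda>n. (1 / real n) *\<^sub>R (\<Sum>k<n. x k))"
    unfolding a_def[symmetric]
  proof (rule CauchyI)
    fix e :: real assume "e > 0"
    \<comment> \<open>Chosen to give
      \<open>4 * ((m + \<epsilon>)\<^sup>2 - m\<^sup>2) < e\<^sup>2\<close>; the cap at 1 bounds the
      square of \<open>\<epsilon>\<close> by \<open>\<epsilon>\<close>.\<close>
    define \<epsilon> where "\<epsilon> = min 1 (e\<^sup>2 / (4 * (2 * m + 1) + 1))"
    have \<epsilon>: "\<epsilon> > 0" using \<open>e > 0\<close> m_nonneg by (auto simp: \<epsilon>_def intro!: divide_pos_pos)
    have \<epsilon>2: "4 * ((m + \<epsilon>)\<^sup>2 - m\<^sup>2) < e\<^sup>2"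
    proof -
      have "\<epsilon> \<le> 1" by (simp add: \<epsilon>_def)
      then have "(m + \<epsilon>)\<^sup>2 - m\<^sup>2 \<le> \<epsilon> * (2 * m + 1)"
        using \<epsilon> by (simp add: power2_eq_square algebra_simps)
      then have "4 * ((m + \<epsilon>)\<^sup>2 - m\<^sup>2) < \<epsilon> * (4 * (2 * m + 1) + 1)"
        using \<epsilon> by (simp add: algebra_simps)
      also have "\<dots> \<le> e\<^sup>2"
      proof -
        have "\<epsilon> \<le> e\<^sup>2 / (4 * (2 * m + 1) + 1)" by (simp add: \<epsilon>_def)
        then show ?thesis using m_nonneg by (simp add: pos_le_divide_eq)
      qed
      finally show ?thesis .
    qed
    obtain N0 where N0: "N0 > 0" "\<And>N. N \<ge> N0 \<Longrightarrow> norm (a N) < m + \<epsilon>"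
      using upper[OF \<epsilon>] by blast
    have "norm (a n - a l) < e" if "n \<ge> N0" "l \<ge> N0" for n l
    proof -
      define L where "L = max n l"
      define c where "c k = (p n k + p l k) / 2" for k
      have "(\<Sum>k<L. c k) = 1"
        unfolding c_def sum_divide_distrib[symmetric] sum.distrib
        using that N0(1) by (subst (1 2) coef_sum) (auto simp: L_def)
      \<comment> \<open>The midpoint is again a convex combination, so its norm is at least
        \<open>m\<close>; this is the lower bound the parallelogram law needs.\<close>
      moreover have "(1/2) *\<^sub>R (a n + a l) = (\<Sum>k<L. c k *\<^sub>R x k)"
        using a_coef[of n L] a_coef[of l L]
        by (simp add: L_def c_def scaleR_add_right scaleR_add_left sum.distrib scaleR_sum_right add_divide_distrib)
      ultimately have "m \<le> norm ((1/2) *\<^sub>R (a n + a l))"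
        using m_le[of c L] by (simp add: c_def p_nonneg)
      then have "2 * m \<le> norm (a n + a l)" by simp
      then have "(2 * m)\<^sup>2 \<le> (norm (a n + a l))\<^sup>2" using m_nonneg by (intro power_mono) auto
      moreover have "(norm (a n - a l))\<^sup>2 + (norm (a n + a l))\<^sup>2 = 2 * (norm (a n))\<^sup>2 + 2 * (norm (a l))\<^sup>2"
        by (simp add: power2_norm_eq_inner inner_add_left inner_add_right inner_diff_left inner_diff_right)
      moreover have "(norm (a n))\<^sup>2 \<le> (m + \<epsilon>)\<^sup>2" "(norm (a l))\<^sup>2 \<le> (m + \<epsilon>)\<^sup>2"
        using N0(2)[OF that(1)] N0(2)[OF that(2)] by (auto intro!: power_mono)
      ultimately have "(norm (a n - a l))\<^sup>2 < e\<^sup>2" using \<epsilon>2 by (simp add: power_mult_distrib)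
      then show ?thesis using \<open>e > 0\<close> power_less_imp_less_base by fastforce
    qed
    then show "\<exists>N. \<forall>n\<ge>N. \<forall>l\<ge>N. norm (a n - a l) < e" by blast
  qed
qed

section \<open>Linear relations, lattice boxes and auxiliary operators\<close>

lemma linear_relation_if_card_less:
  fixes v :: "'i \<Rightarrow> 'a::real_vector"
  assumes "finite F" "finite X" "v ` F \<subseteq> span X" "card X < card F"
  obtains c where "\<exists>i\<in>F. c i \<noteq> (0::real)" "(\<Sum>i\<in>F. c i *\<^sub>R v i) = 0"
proof (cases "inj_on v F")
  case True
  then have "dependent (v ` F)"
    using independent_span_bound[OF assms(2) _ assms(3)] assms(4) card_image[of v F] by auto
  then obtain u where u: "\<exists>w\<in>v ` F. u w \<noteq> 0" "(\<Sum>w\<in>v ` F. u w *\<^sub>R w) = 0"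
    using assms(1) by (auto simp: dependent_finite)
  with True show thesis
    by (intro that[of "u \<circ> v"]) (auto simp: sum.reindex)
next
  case False
  then obtain i j where ij: "i \<in> F" "j \<in> F" "i \<noteq> j" "v i = v j"
    by (auto simp: inj_on_def)
  \<comment> \<open>Equal vectors at two different indices already form a relation.\<close>
  define c where "c k = (if k = i then 1 else if k = j then - 1 else 0 :: real)" for k
  have "(\<Sum>k\<in>F. c k *\<^sub>R v k) = (\<Sum>k\<in>{i, j}. c k *\<^sub>R v k)"
    using ij assms(1) by (intro sum.mono_neutral_right) (auto simp: c_def)
  also have "\<dots> = 0" using ij by (simp add: c_def)
  finally show thesis using ij by (intro that[of c]) (auto simp: c_def)
qed

definition lattice_box :: "nat \<Rightarrow> (int ^ 'd) set"
  where "lattice_box L = {x. \<forall>i. \<bar>x $ i\<bar> \<le> int L}"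

lemma card_lattice_box: "card (lattice_box L :: (int ^ 'd) set) = (2 * L + 1) ^ CARD('d)"
  and finite_lattice_box: "finite (lattice_box L :: (int ^ 'd) set)"
proof -
  let ?P = "PiE (UNIV :: 'd set) (\<lambda>_. {- int L..int L})"
  have b: "bij_betw vec_nth (lattice_box L :: (int ^ 'd) set) ?P"
    by (rule bij_betw_byWitness[where f'=vec_lambda]) (auto simp: lattice_box_def PiE_def Pi_def abs_le_iff minus_le_iff)
  have "card ?P = (2 * L + 1) ^ CARD('d)"
    by (simp add: card_PiE nat_add_distrib nat_mult_distrib)
  then show "card (lattice_box L :: (int ^ 'd) set) = (2 * L + 1) ^ CARD('d)"
    using bij_betw_same_card[OF b] by simp
  show "finite (lattice_box L :: (int ^ 'd) set)"
    using bij_betw_finite[OF b] by (simp add: finite_PiE)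
qed

lemma has_sum_sum_family:
  fixes f :: "'a \<Rightarrow> 'b \<Rightarrow> real"
  assumes "finite I" "\<And>i. i \<in> I \<Longrightarrow> (f i has_sum s i) M"
  shows "((\<lambda>x. \<Sum>i\<in>I. f i x) has_sum (\<Sum>i\<in>I. s i)) M"
  using assms by (induction I rule: finite_induct) (auto intro: has_sum_add)

lemma funpow_blinfun_compose:
  fixes B :: "'a::real_normed_vector \<Rightarrow>\<^sub>L 'a"
  shows "blinfun_apply ((blinfun_compose B ^^ k) id_blinfun) f = (blinfun_apply B ^^ k) f"
  by (induction k arbitrary: f) simp_all

lemma lattice_box_mono:
  assumes "L \<le> M"
  shows "lattice_box L \<subseteq> lattice_box M"
proof -
  have "int L \<le> int M" using assms by simp
  then show ?thesis unfolding lattice_box_def using order_trans by blast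
qed

lemma lattice_box_add:
  assumes "a \<in> lattice_box M" "b \<in> lattice_box L"
  shows "a + b \<in> lattice_box (L + M)"
  unfolding lattice_box_def mem_Collect_eq
proof
  fix i
  have "\<bar>a $ i\<bar> \<le> int M" "\<bar>b $ i\<bar> \<le> int L"
    using assms by (auto simp: lattice_box_def)
  then show "\<bar>(a + b) $ i\<bar> \<le> int (L + M)"
    unfolding vector_add_component of_nat_add by linarith
qed

definition rank_one :: "'w \<Rightarrow> 'w \<Rightarrow> 'w::real_inner \<Rightarrow>\<^sub>L 'w"
  where "rank_one v w = Blinfun (\<lambda>x. inner x v *\<^sub>R w)"

lemma rank_one_apply [simp]: "rank_one v w x = inner x v *\<^sub>R w"
  unfolding rank_one_def by (subst bounded_linear_Blinfun_apply) (auto intro!: bounded_linear_intros)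

section \<open>Asymptotic velocity of a walk\<close>

text \<open>\<open>u t\<close> is the block of \<open>U\<close> for the displacement
  \<open>t\<close>, and the explicit inverse \<open>V\<close> makes the isometry \<open>U\<close>
  unitary. Everything in the locale is real linear; complex scalars return with the
  eigenvectors.\<close>

locale walk =
  fixes S :: "(int ^ 'd) set" and u :: "int ^ 'd \<Rightarrow> 'w::real_inner \<Rightarrow>\<^sub>L 'w" and E :: "'w set"
    and U V :: "(int ^ 'd, 'w) l2 \<Rightarrow>\<^sub>L (int ^ 'd, 'w) l2"
  assumes finite_S: "finite S"
    and frame: "tight_frame E"
    and coord_U: "coord (U f) x = (\<Sum>t\<in>S. u t (coord f (x - t)))"
    and UV [simp]: "U (V f) = f"
    and VU [simp]: "V (U f) = f"
    and inner_U [simp]: "inner (U f) (U g) = inner f g"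
begin

section \<open>Unitarity and translation invariance\<close>

lemma inner_U_left: "inner (U f) g = inner f (V g)"
  by (metis UV inner_U)

lemma inner_V_left: "inner (V f) g = inner f (U g)"
  by (metis inner_U UV)

lemma norm_U [simp]: "norm (U f) = norm f"
  by (simp add: norm_eq_sqrt_inner)

lemma norm_V [simp]: "norm (V f) = norm f"
  by (metis norm_U UV)

lemma U_shift: "U (shift a f) = shift a (U f)"
  by (rule l2_eqI) (simp add: coord_U diff_diff_eq add.commute)

lemma V_shift: "V (shift a f) = shift a (V f)"
  by (metis U_shift UV VU)

abbreviation U_pow where "U_pow k \<equiv> (blinfun_apply U ^^ k)"
abbreviation V_pow where "V_pow k \<equiv> (blinfun_apply V ^^ k)"

lemma U_pow_V_pow [simp]: "U_pow k (V_pow k f) = f"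
  by (induction k arbitrary: f) (simp_all add: funpow_swap1)

lemma V_pow_U_pow [simp]: "V_pow k (U_pow k f) = f"
  by (induction k arbitrary: f) (simp_all add: funpow_swap1)

lemma linear_U_pow: "linear (U_pow k)"
  by (induction k) (auto intro!: linearI simp: blinfun.add_right blinfun.scaleR_right linear_add linear_scale)

lemma inner_U_pow_left: "inner (U_pow k f) g = inner f (V_pow k g)"
  by (induction k arbitrary: f g) (simp_all add: inner_U_left funpow_swap1)

lemma inner_V_pow_left: "inner (V_pow k f) g = inner f (U_pow k g)"
  by (induction k arbitrary: f g) (simp_all add: inner_V_left funpow_swap1)

lemma norm_U_pow [simp]: "norm (U_pow k f) = norm f"
  by (induction k) simp_all

lemma norm_V_pow [simp]: "norm (V_pow k f) = norm f"
  by (induction k) simp_all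

lemma V_pow_shift: "V_pow k (shift a f) = shift a (V_pow k f)"
  by (induction k) (simp_all add: V_shift)

text \<open>
  \<open>D j\<close> is the commutator of \<open>U\<close> with the unbounded position operator in direction \<open>j\<close>;
  \<open>X j R\<close> is the position operator truncated to \<open>[-R, R]\<close>.
\<close>

definition D :: "'d \<Rightarrow> (int ^ 'd, 'w) l2 \<Rightarrow>\<^sub>L (int ^ 'd, 'w) l2"
  where "D j = (\<Sum>t\<in>S. real_of_int (t $ j) *\<^sub>R (shift t o\<^sub>L fibre_op (u t)))"

definition clamp :: "nat \<Rightarrow> int \<Rightarrow> real"
  where "clamp R i = max (- real R) (min (real R) (real_of_int i))"

definition X :: "'d \<Rightarrow> nat \<Rightarrow> (int ^ 'd, 'w) l2 \<Rightarrow>\<^sub>L (int ^ 'd, 'w) l2"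
  where "X j R = mult_op (\<lambda>x. clamp R (x $ j))"

lemma coord_X [simp]: "coord (X j R f) x = clamp R (x $ j) *\<^sub>R coord f x"
  unfolding X_def by (rule coord_mult_op[where C="real R"]) (auto simp: clamp_def)

lemma inner_X_left: "inner (X j R f) g = inner f (X j R g)"
  by (simp add: inner_l2_def)

lemma coord_D: "coord (D j f) x = (\<Sum>t\<in>S. real_of_int (t $ j) *\<^sub>R u t (coord f (x - t)))"
  by (simp add: D_def blinfun.sum_left blinfun.scaleR_left)

lemma clamp_diff_le: "\<bar>clamp R i - clamp R (i - k)\<bar> \<le> \<bar>real_of_int k\<bar>"
  by (auto simp: clamp_def)

lemma clamp_eq: "\<bar>i\<bar> \<le> int R \<Longrightarrow> clamp R i = real_of_int i"
  by (auto simp: clamp_def)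

lemma abs_clamp_le: "\<bar>clamp R i\<bar> \<le> \<bar>real_of_int i\<bar>"
  by (auto simp: clamp_def)

section \<open>Truncated commutators with position\<close>

definition comm :: "'d \<Rightarrow> nat \<Rightarrow> (int ^ 'd, 'w) l2 \<Rightarrow> (int ^ 'd, 'w) l2"
  where "comm j R f = X j R (U f) - U (X j R f)"

lemma coord_comm:
  "coord (comm j R f) x = (\<Sum>t\<in>S. (clamp R (x $ j) - clamp R (x $ j - t $ j)) *\<^sub>R u t (coord f (x - t)))"
  by (simp add: comm_def coord_U blinfun.scaleR_right scaleR_sum_right scaleR_left_diff_distrib sum_subtractf)

definition comm_bound :: "'d \<Rightarrow> real"
  where "comm_bound j = (\<Sum>t\<in>S. \<bar>real_of_int (t $ j)\<bar> * norm (u t))"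

text \<open>The clamp is 1-Lipschitz, so a step \<open>t\<close> contributes at most its
  \<open>j\<close>-th coordinate times \<open>norm (u t)\<close>, uniformly in
  \<open>R\<close>.\<close>

lemma norm_comm_le: "norm (comm j R f) \<le> comm_bound j * norm f"
proof -
  define G where "G t = mult_op (\<lambda>x. clamp R (x $ j) - clamp R (x $ j - t $ j)) (shift t (fibre_op (u t) f))"
    for t :: "int ^ 'd"
  have cG: "coord (G t) x = (clamp R (x $ j) - clamp R (x $ j - t $ j)) *\<^sub>R u t (coord f (x - t))" for t x
    unfolding G_def by (subst coord_mult_op[OF clamp_diff_le]) simp
  have "comm j R f = (\<Sum>t\<in>S. G t)"
    by (rule l2_eqI) (simp add: coord_comm cG)
  moreover have "norm (G t) \<le> (\<bar>real_of_int (t $ j)\<bar> * norm (u t)) * norm (shift t f)" for t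
  proof (rule norm_l2_le)
    fix x
    have "norm (coord (G t) x) \<le> \<bar>real_of_int (t $ j)\<bar> * (norm (u t) * norm (coord f (x - t)))"
      unfolding cG norm_scaleR by (intro mult_mono clamp_diff_le norm_blinfun) auto
    then show "norm (coord (G t) x) \<le> \<bar>real_of_int (t $ j)\<bar> * norm (u t) * norm (coord (shift t f) x)"
      by (simp add: mult.assoc)
  qed simp
  ultimately show ?thesis
    unfolding comm_bound_def sum_distrib_right by (auto intro!: sum_norm_le)
qed

text \<open>Against a vector at one site the truncation is exact for all large \<open>R\<close>; the
  bound uniform in \<open>R\<close> extends the limit to all \<open>v\<close>.\<close>

lemma comm_tendsto: "(\<lambda>R. inner v (comm j R f)) \<longlonglongrightarrow> inner v (D j f)"
proof -
  have "(\<lambda>R. inner v (comm j R f - D j f)) \<longlonglongrightarrow> 0"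
  proof (rule tendsto_0_if_singles[where \<phi>="\<lambda>R v. inner v (comm j R f - D j f)"
        and C="comm_bound j * norm f + norm (D j f)"])
    show "linear (\<lambda>v. inner v (comm j R f - D j f))" for R
      by (intro linearI) (simp_all add: inner_add_left)
    show "\<bar>inner v (comm j R f - D j f)\<bar> \<le> (comm_bound j * norm f + norm (D j f)) * norm v" for R v
    proof -
      have "norm (comm j R f - D j f) \<le> comm_bound j * norm f + norm (D j f)"
        using norm_triangle_ineq4[of "comm j R f" "D j f"] norm_comm_le[of j R f] by linarith
      then show ?thesis
        using Cauchy_Schwarz_ineq2[of v "comm j R f - D j f"]
          mult_left_mono[of "norm (comm j R f - D j f)" _ "norm v"] by (fastforce simp: mult.commute)
    qed
    show "(\<lambda>R. inner (single x w) (comm j R f - D j f)) \<longlonglongrightarrow> 0" for x w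
    proof (rule tendsto_eventually)
      show "\<forall>\<^sub>F R in sequentially. inner (single x w) (comm j R f - D j f) = 0"
        unfolding eventually_sequentially
      proof (intro exI allI impI)
        \<comment> \<open>Such an \<open>R\<close> leaves the clamp inactive at \<open>x\<close> and
          at every \<open>x - t\<close> with \<open>t \<in> S\<close>.\<close>
        fix R assume R: "nat \<bar>x $ j\<bar> + (\<Sum>t\<in>S. nat \<bar>t $ j\<bar>) \<le> R"
        have "clamp R (x $ j) - clamp R (x $ j - t $ j) = real_of_int (t $ j)" if "t \<in> S" for t
        proof -
          have "nat \<bar>t $ j\<bar> \<le> (\<Sum>t\<in>S. nat \<bar>t $ j\<bar>)"
            using that finite_S by (intro member_le_sum) auto
          with R have "\<bar>x $ j\<bar> \<le> int R" "\<bar>x $ j - t $ j\<bar> \<le> int R" by auto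
          then show ?thesis by (simp add: clamp_eq)
        qed
        then show "inner (single x w) (comm j R f - D j f) = 0"
          by (simp add: coord_comm coord_D)
      qed
    qed
  qed
  then show ?thesis by (simp add: inner_diff_right LIM_zero_cancel)
qed

section \<open>Averaged displacement\<close>

definition conj_U :: "((int ^ 'd, 'w) l2 \<Rightarrow>\<^sub>L (int ^ 'd, 'w) l2) \<Rightarrow> ((int ^ 'd, 'w) l2 \<Rightarrow>\<^sub>L (int ^ 'd, 'w) l2)"
  where "conj_U B = U o\<^sub>L B o\<^sub>L V"

text \<open>Formally this is \<open>U^k X U^-k - U^(k+1) X U^-(k+1)\<close> with \<open>X\<close>
  the untruncated position operator, so sums over \<open>k\<close> telescope.\<close>

definition orbit :: "'d \<Rightarrow> nat \<Rightarrow> ((int ^ 'd, 'w) l2 \<Rightarrow>\<^sub>L (int ^ 'd, 'w) l2)"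
  where "orbit j k = (conj_U ^^ k) (D j o\<^sub>L V)"

text \<open>The mean over \<open>n\<close> steps of the displacement per step in direction \<open>j\<close>.\<close>

definition A :: "'d \<Rightarrow> nat \<Rightarrow> ((int ^ 'd, 'w) l2 \<Rightarrow>\<^sub>L (int ^ 'd, 'w) l2)"
  where "A j n = (1 / real n) *\<^sub>R (\<Sum>k<n. orbit j k)"

lemma conj_U_add: "conj_U (B + C) = conj_U B + conj_U C"
  and conj_U_diff: "conj_U (B - C) = conj_U B - conj_U C"
  by (rule blinfun_eqI; simp add: conj_U_def blinfun.bilinear_simps)+

lemma orbit_Suc: "orbit j (Suc k) = conj_U (orbit j k)"
  by (simp add: orbit_def)

lemma orbit_apply: "orbit j k f = U_pow k (D j (V_pow (Suc k) f))"
  by (induction k arbitrary: f) (simp_all add: orbit_Suc conj_U_def orbit_def[of j 0] funpow_swap1)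

lemma norm_orbit_le: "norm (orbit j k f) \<le> norm (D j) * norm f"
  using norm_blinfun[of "D j" "V_pow (Suc k) f"] unfolding orbit_apply by simp

lemma norm_A_le: "norm (A j n f) \<le> norm (D j) * norm f"
proof (cases "n = 0")
  case False
  have "norm (\<Sum>k<n. orbit j k f) \<le> (\<Sum>k<n. norm (D j) * norm f)"
    by (intro sum_norm_le norm_orbit_le)
  with False show ?thesis
    by (simp add: A_def blinfun.scaleR_left blinfun.sum_left field_simps)
qed (simp add: A_def)

text \<open>The telescoping is done with truncated position operators, which are bounded;
  \<open>R\<close> tends to infinity afterwards in \<open>sum_orbit_tendsto\<close>.\<close>

lemma telescope:
  "(\<Sum>k<n. U_pow k (comm j R (V_pow (Suc k) f))) = X j R f - U_pow n (X j R (V_pow n f))"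
proof (induction n)
  case (Suc n)
  have "U_pow n (comm j R (V_pow (Suc n) f)) = U_pow n (X j R (V_pow n f)) - U_pow (Suc n) (X j R (V_pow (Suc n) f))"
    by (simp add: comm_def linear_diff[OF linear_U_pow] flip: funpow_swap1)
  with Suc show ?case by (simp del: funpow.simps)
qed simp

lemma sum_orbit_tendsto:
  "(\<lambda>R. inner v (X j R f - U_pow n (X j R (V_pow n f)))) \<longlonglongrightarrow> inner v (\<Sum>k<n. orbit j k f)"
proof -
  have "(\<lambda>R. inner (V_pow k v) (comm j R (V_pow (Suc k) f))) \<longlonglongrightarrow> inner (V_pow k v) (D j (V_pow (Suc k) f))" for k
    by (rule comm_tendsto)
  then have "(\<lambda>R. inner v (U_pow k (comm j R (V_pow (Suc k) f)))) \<longlonglongrightarrow> inner v (orbit j k f)" for k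
    by (simp only: inner_V_pow_left orbit_apply)
  then show ?thesis
    unfolding telescope[symmetric] inner_sum_right by (intro tendsto_sum)
qed

lemma norm_X_single_le: "norm (X j R (single x w)) \<le> \<bar>real_of_int (x $ j)\<bar> * norm w"
proof -
  have "X j R (single x w) = single x (clamp R (x $ j) *\<^sub>R w)"
    by (rule l2_eqI) simp
  then show ?thesis by (simp add: mult_right_mono abs_clamp_le)
qed

text \<open>\<open>m\<close> times \<open>A j m\<close> is a weak limit of truncations of
  \<open>X - U^m X U^-m\<close>. In this matrix element the first \<open>X\<close> acts on
  \<open>single x a\<close> and, once \<open>U_pow m\<close> is moved across, the second acts on
  \<open>single z b\<close>; each costs at most one coordinate, whatever \<open>R\<close>
  is.\<close>

lemma A_decay:
  "\<bar>inner (A j m (single x a)) (U_pow m (single z b))\<bar>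
     \<le> (\<bar>real_of_int (x $ j)\<bar> + \<bar>real_of_int (z $ j)\<bar>) * norm a * norm b / real m"
proof (cases "m = 0")
  case False
  define f g where "f = single x a" and "g = single z b"
  define B where "B = (\<bar>real_of_int (x $ j)\<bar> + \<bar>real_of_int (z $ j)\<bar>) * norm a * norm b"
  have "\<bar>inner (U_pow m g) (X j R f - U_pow m (X j R (V_pow m f)))\<bar> \<le> B" for R
  proof -
    have "inner (U_pow m g) (X j R f - U_pow m (X j R (V_pow m f)))
        = inner (U_pow m g) (X j R f) - inner (X j R g) (V_pow m f)"
      by (simp add: inner_diff_right inner_U_pow_left inner_X_left)
    moreover have "\<bar>inner (U_pow m g) (X j R f)\<bar> \<le> norm b * (\<bar>real_of_int (x $ j)\<bar> * norm a)"
      by (rule order_trans[OF Cauchy_Schwarz_ineq2])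
         (auto simp: f_def g_def intro!: mult_mono norm_X_single_le)
    moreover have "\<bar>inner (X j R g) (V_pow m f)\<bar> \<le> (\<bar>real_of_int (z $ j)\<bar> * norm b) * norm a"
      by (rule order_trans[OF Cauchy_Schwarz_ineq2])
         (auto simp: f_def g_def intro!: mult_mono norm_X_single_le)
    ultimately show ?thesis by (simp add: B_def algebra_simps)
  qed
  then have "\<bar>inner (U_pow m g) (\<Sum>k<m. orbit j k f)\<bar> \<le> B"
    by (intro LIMSEQ_le_const2[OF tendsto_rabs[OF sum_orbit_tendsto]]) auto
  moreover have "inner (A j m f) (U_pow m g) = inner (U_pow m g) (\<Sum>k<m. orbit j k f) / real m"
    by (simp add: A_def blinfun.scaleR_left blinfun.sum_left inner_commute)
  ultimately show ?thesis
    using False by (simp add: f_def g_def B_def divide_right_mono)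
qed (simp add: A_def)

section \<open>Hilbert-Schmidt norm per unit volume\<close>

text \<open>The squared norm of \<open>hs B\<close> is the trace per unit volume of
  \<open>B* B\<close>. It is stored as a vector, with one copy of the Hilbert space for each frame
  element, so that the mean ergodic argument applies to operators.\<close>

definition hs :: "((int ^ 'd, 'w) l2 \<Rightarrow>\<^sub>L (int ^ 'd, 'w) l2) \<Rightarrow> ('w, (int ^ 'd, 'w) l2) l2"
  where "hs B = (\<Sum>e\<in>E. single e (B (single 0 e)))"

lemma finite_E: "finite E"
  using frame by (simp add: tight_frame_def)

lemma coord_hs: "coord (hs B) e = (if e \<in> E then B (single 0 e) else 0)"
  by (simp add: hs_def finite_E)

lemma norm_hs: "(norm (hs B))\<^sup>2 = (\<Sum>e\<in>E. (norm (B (single 0 e)))\<^sup>2)"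
proof -
  have "inner (hs B) (hs B) = (\<Sum>e\<in>E. inner (hs B) (single e (B (single 0 e))))"
    by (subst (2) hs_def) (simp add: inner_sum_right)
  then show ?thesis by (simp add: power2_norm_eq_inner coord_hs)
qed

lemma linear_hs: "linear hs"
  by (intro linearI)
     (simp_all add: hs_def blinfun.add_left blinfun.scaleR_left single_add single_scaleR sum.distrib scaleR_sum_right)

text \<open>The adjoint is carried along as a plain function; its existence is established term by
  term through the closure rules below.\<close>

definition tracial :: "((int ^ 'd, 'w) l2 \<Rightarrow>\<^sub>L (int ^ 'd, 'w) l2) \<Rightarrow> ((int ^ 'd, 'w) l2 \<Rightarrow> (int ^ 'd, 'w) l2) \<Rightarrow> bool"
  where "tracial B B' \<longleftrightarrow> (\<forall>a f. B (shift a f) = shift a (B f)) \<and> (\<forall>f g. inner (B f) g = inner f (B' g))"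

lemma has_sum_frame: "((\<lambda>x. \<Sum>e\<in>E. (inner (coord f x) e)\<^sup>2) has_sum (norm f)\<^sup>2) UNIV"
proof -
  have "(\<Sum>e\<in>E. (inner (coord f x) e)\<^sup>2) = (norm (coord f x))\<^sup>2" for x
    using tight_frame_inner[OF frame, of "coord f x" "coord f x"]
    unfolding power2_norm_eq_inner by (simp add: power2_eq_square)
  then show ?thesis using has_sum_norm_square_l2[of f] by simp
qed

text \<open>Traciality: translation invariance turns the matrix elements of \<open>B\<close> at
  \<open>x\<close> into those of its adjoint at \<open>- x\<close>, so \<open>B* B\<close> and
  \<open>B B*\<close> have the same trace per unit volume.\<close>

lemma norm_hs_adjoint:
  assumes "tracial B B'"
  shows "(norm (hs B))\<^sup>2 = (\<Sum>e\<in>E. (norm (B' (single 0 e)))\<^sup>2)"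
proof -
  have comm: "B (shift a f) = shift a (B f)" and adj: "inner (B f) g = inner f (B' g)" for a f g
    using assms by (auto simp: tracial_def)
  have swap: "inner (coord (B (single 0 e)) x) e' = inner (coord (B' (single 0 e')) (- x)) e" for e e' x
  proof -
    have "inner (coord (B (single 0 e)) x) e' = inner (shift (- x) (B (single 0 e))) (single 0 e')"
      by simp
    also have "\<dots> = inner (B (single (- x) e)) (single 0 e')"
      by (simp flip: comm)
    also have "\<dots> = inner (single (- x) e) (B' (single 0 e'))"
      by (rule adj)
    also have "\<dots> = inner (coord (B' (single 0 e')) (- x)) e"
      by (simp add: inner_commute)
    finally show ?thesis .
  qed
  have "((\<lambda>x. \<Sum>e\<in>E. \<Sum>e'\<in>E. (inner (coord (B (single 0 e)) x) e')\<^sup>2) has_sum (norm (hs B))\<^sup>2) UNIV"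
    unfolding norm_hs by (intro has_sum_sum_family finite_E has_sum_frame)
  moreover have "((\<lambda>x. \<Sum>e'\<in>E. \<Sum>e\<in>E. (inner (coord (B' (single 0 e')) (- x)) e)\<^sup>2)
      has_sum (\<Sum>e'\<in>E. (norm (B' (single 0 e')))\<^sup>2)) UNIV"
  proof (intro has_sum_sum_family finite_E)
    fix e'
    have "bij (uminus :: int ^ 'd \<Rightarrow> int ^ 'd)"
      by (rule bij_betw_byWitness[where f'=uminus]) auto
    from has_sum_reindex_bij_betw[OF this, of "\<lambda>x. \<Sum>e\<in>E. (inner (coord (B' (single 0 e')) x) e)\<^sup>2"]
    show "((\<lambda>x. \<Sum>e\<in>E. (inner (coord (B' (single 0 e')) (- x)) e)\<^sup>2) has_sum (norm (B' (single 0 e')))\<^sup>2) UNIV"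
      using has_sum_frame by blast
  qed
  ultimately show ?thesis
    unfolding swap by (subst (asm) sum.swap) (rule has_sum_unique)
qed

lemma tracial_add: "tracial B B' \<Longrightarrow> tracial C C' \<Longrightarrow> tracial (B + C) (\<lambda>f. B' f + C' f)"
  by (simp add: tracial_def blinfun.add_left blinfun.add_right inner_add_left inner_add_right)

lemma tracial_scaleR: "tracial B B' \<Longrightarrow> tracial (r *\<^sub>R B) (\<lambda>f. r *\<^sub>R B' f)"
  by (simp add: tracial_def blinfun.scaleR_left blinfun.scaleR_right)

lemma tracial_diff: "tracial B B' \<Longrightarrow> tracial C C' \<Longrightarrow> tracial (B - C) (\<lambda>f. B' f - C' f)"
  by (simp add: tracial_def blinfun.diff_left blinfun.diff_right inner_diff_left inner_diff_right)

lemma tracial_sum: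
  "(\<And>i. i \<in> I \<Longrightarrow> tracial (B i) (B' i)) \<Longrightarrow> tracial (\<Sum>i\<in>I. B i) (\<lambda>f. \<Sum>i\<in>I. B' i f)"
  by (induction I rule: infinite_finite_induct)
     (auto intro: tracial_add, auto simp: tracial_def)

lemma tracial_compose: "tracial B B' \<Longrightarrow> tracial C C' \<Longrightarrow> tracial (B o\<^sub>L C) (C' \<circ> B')"
  by (simp add: tracial_def)

lemma tracial_U: "tracial U V" and tracial_V: "tracial V U"
  by (simp_all add: tracial_def U_shift V_shift inner_U_left inner_V_left)

lemma tracial_conj_U: "tracial B B' \<Longrightarrow> tracial (conj_U B) (U \<circ> B' \<circ> V)"
  using tracial_compose[OF tracial_compose[OF tracial_U, of B B'] tracial_V]
  by (simp add: conj_U_def comp_assoc)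

text \<open>The outer \<open>U\<close> is an isometry. The inner \<open>V\<close> is removed by
  passing to the adjoint, where it becomes an isometry on the left.\<close>

lemma norm_hs_conj_U:
  assumes "tracial B B'"
  shows "norm (hs (conj_U B)) = norm (hs B)"
proof -
  have "(norm (hs (conj_U B)))\<^sup>2 = (norm (hs (B o\<^sub>L V)))\<^sup>2"
    unfolding norm_hs by (simp add: conj_U_def)
  also have "\<dots> = (norm (hs B))\<^sup>2"
    using norm_hs_adjoint[OF tracial_compose[OF assms tracial_V]] norm_hs_adjoint[OF assms] by simp
  finally show ?thesis by simp
qed

text \<open>The frame expansion of \<open>v\<close> supplies the adjoint of \<open>u t\<close>
  explicitly.\<close>

lemma fibre_adjoint: "inner (u t v) w = inner v (\<Sum>e\<in>E. inner (u t e) w *\<^sub>R e)"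
proof -
  have "u t v = u t (\<Sum>e\<in>E. inner v e *\<^sub>R e)"
    using frame by (simp add: tight_frame_def)
  then show ?thesis
    by (simp add: blinfun.sum_right blinfun.scaleR_right inner_sum_left inner_sum_right mult.commute)
qed

lemma tracial_D: "\<exists>B'. tracial (D j) B'"
proof -
  define g where "g t = Blinfun (\<lambda>w. \<Sum>e\<in>E. inner (u t e) w *\<^sub>R e)" for t
  have g: "g t w = (\<Sum>e\<in>E. inner (u t e) w *\<^sub>R e)" for t w
    unfolding g_def
    by (subst bounded_linear_Blinfun_apply) (auto intro!: bounded_linear_intros bounded_linear_sum)
  have adj: "inner (u t v) w = inner v (g t w)" for t v w
    by (simp only: g fibre_adjoint[of t v w])
  have "tracial (shift t o\<^sub>L fibre_op (u t)) (\<lambda>f. fibre_op (g t) (shift (- t) f))" for t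
    unfolding tracial_def
  proof (intro conjI allI)
    fix a f h
    show "(shift t o\<^sub>L fibre_op (u t)) (shift a f) = shift a ((shift t o\<^sub>L fibre_op (u t)) f)"
      by (rule l2_eqI) (simp add: algebra_simps)
    show "inner ((shift t o\<^sub>L fibre_op (u t)) f) h = inner f (fibre_op (g t) (shift (- t) h))"
      by (simp add: inner_shift_left) (simp add: inner_l2_def adj)
  qed
  then show ?thesis
    unfolding D_def by - (rule exI, rule tracial_sum, rule tracial_scaleR, assumption)
qed

lemma tracial_orbit: "\<exists>B'. tracial (orbit j k) B'"
proof (induction k)
  case 0
  then show ?case using tracial_D tracial_compose[OF _ tracial_V] by (simp add: orbit_def) blast
next
  case (Suc k)
  then show ?case using tracial_conj_U unfolding orbit_Suc by blast
qed

lemma tracial_A: "\<exists>B'. tracial (A j n) B'"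
proof -
  obtain B' where "\<And>k. tracial (orbit j k) (B' k)" using tracial_orbit by metis
  then show ?thesis
    unfolding A_def by - (rule exI, rule tracial_scaleR, rule tracial_sum, assumption)
qed

text \<open>Conjugation by \<open>U\<close> preserves the norm of \<open>hs\<close>, hence by
  polarisation the inner products, so the vectors \<open>hs (orbit j k)\<close> are
  stationary.\<close>

lemma Cauchy_hs_A: "Cauchy (\<lambda>n. hs (A j n))"
proof -
  have "inner (hs (orbit j (Suc k))) (hs (orbit j (Suc l))) = inner (hs (orbit j k)) (hs (orbit j l))" for k l
  proof -
    obtain B' C' where B: "tracial (orbit j k) B'" and C: "tracial (orbit j l) C'"
      using tracial_orbit by blast
    have "norm (hs (orbit j (Suc k) + orbit j (Suc l))) = norm (hs (orbit j k + orbit j l))"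
      using norm_hs_conj_U[OF tracial_add[OF B C]]
      by (simp add: orbit_Suc conj_U_add)
    moreover have "norm (hs (orbit j (Suc k) - orbit j (Suc l))) = norm (hs (orbit j k - orbit j l))"
      using norm_hs_conj_U[OF tracial_diff[OF B C]]
      by (simp add: orbit_Suc conj_U_diff)
    moreover have "inner v w = ((norm (v + w))\<^sup>2 - (norm (v - w))\<^sup>2) / 4" for v w :: "('w, (int ^ 'd, 'w) l2) l2"
      by (simp add: power2_norm_eq_inner inner_add_left inner_add_right inner_diff_left inner_diff_right inner_commute)
    ultimately show ?thesis by (simp only: linear_add[OF linear_hs] linear_diff[OF linear_hs])
  qed
  from mean_ergodic_Cauchy[of "\<lambda>k. hs (orbit j k)", OF this] show ?thesis
    by (simp add: A_def linear_scale[OF linear_hs] linear_sum[OF linear_hs])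
qed

text \<open>Translation invariance moves the site to 0, where \<open>hs\<close> records the values
  of \<open>B\<close> on the frame.\<close>

lemma norm_single_le_hs:
  assumes "tracial B B'"
  shows "norm (B (single x w)) \<le> (\<Sum>e\<in>E. \<bar>inner w e\<bar>) * norm (hs B)"
proof -
  have comm: "B (shift a f) = shift a (B f)" for a f
    using assms by (simp add: tracial_def)
  have "shift x (\<Sum>e\<in>E. inner w e *\<^sub>R single 0 e) = single x w"
    using frame by (simp add: tight_frame_def flip: single_sum single_scaleR)
  then have "B (single x w) = shift x (B (\<Sum>e\<in>E. inner w e *\<^sub>R single 0 e))"
    by (simp only: flip: comm)
  also have "\<dots> = shift x (\<Sum>e\<in>E. inner w e *\<^sub>R B (single 0 e))"
    by (simp only: blinfun.sum_right blinfun.scaleR_right)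
  finally have "B (single x w) = shift x (\<Sum>e\<in>E. inner w e *\<^sub>R B (single 0 e))" .
  then have "norm (B (single x w)) \<le> (\<Sum>e\<in>E. \<bar>inner w e\<bar> * norm (B (single 0 e)))"
    by (auto intro!: sum_norm_le)
  also have "\<dots> \<le> (\<Sum>e\<in>E. \<bar>inner w e\<bar> * norm (hs B))"
  proof (intro sum_mono mult_left_mono)
    fix e assume "e \<in> E"
    then show "norm (B (single 0 e)) \<le> norm (hs B)"
      using norm_coord_le[of "hs B" e] by (simp add: coord_hs)
  qed simp
  finally show ?thesis by (simp add: sum_distrib_right)
qed

section \<open>States of zero velocity\<close>

lemma A_shift: "A j n (shift a f) = shift a (A j n f)"
  using tracial_A[of j n] by (auto simp: tracial_def)

lemma A_Cauchy:
  assumes "\<epsilon> > 0"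
  obtains N where "\<And>n m. n \<ge> N \<Longrightarrow> m \<ge> N \<Longrightarrow> norm (A j n (single x w) - A j m (single x w)) < \<epsilon>"
proof -
  define c where "c = (\<Sum>e\<in>E. \<bar>inner w e\<bar>)"
  have c: "c \<ge> 0" by (simp add: c_def sum_nonneg)
  then have "\<epsilon> / (c + 1) > 0" using assms by simp
  from CauchyD[OF Cauchy_hs_A this]
  obtain N where N: "\<And>n m. n \<ge> N \<Longrightarrow> m \<ge> N \<Longrightarrow> norm (hs (A j n) - hs (A j m)) < \<epsilon> / (c + 1)"
    by blast
  have "norm (A j n (single x w) - A j m (single x w)) < \<epsilon>" if "n \<ge> N" "m \<ge> N" for n m
  proof -
    obtain B' C' where "tracial (A j n) B'" "tracial (A j m) C'" using tracial_A by blast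
    from norm_single_le_hs[OF tracial_diff[OF this]]
    have "norm (A j n (single x w) - A j m (single x w)) \<le> c * norm (hs (A j n) - hs (A j m))"
      by (simp add: c_def blinfun.diff_left linear_diff[OF linear_hs])
    also have "\<dots> \<le> (c + 1) * norm (hs (A j n) - hs (A j m))"
      by (intro mult_right_mono) auto
    also have "\<dots> < \<epsilon>"
      using N[OF that] c by (simp add: field_simps)
    finally show ?thesis .
  qed
  then show thesis by (rule that)
qed

text \<open>On a one-site vector \<open>A j n\<close> may be replaced by \<open>A j (r k)\<close> at
  small cost when \<open>n\<close> and \<open>k\<close> are large. Its matrix element with
  \<open>U_pow (r k) (single z b)\<close> then vanishes as \<open>k\<close> grows, by
  \<open>A_decay\<close>.\<close>

lemma weak_limit_has_no_velocity:
  assumes r: "strict_mono r" and lim: "\<And>v. (\<lambda>k. inner v (U_pow (r k) (single z b))) \<longlonglongrightarrow> inner v f"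
  shows "(\<lambda>n. inner (A j n v) f) \<longlonglongrightarrow> 0"
proof (rule tendsto_0_if_singles[where \<phi>="\<lambda>n v. inner (A j n v) f" and C="norm (D j) * norm f"])
  show "linear (\<lambda>v. inner (A j n v) f)" for n
    by (intro linearI) (simp_all add: blinfun.add_right blinfun.scaleR_right inner_add_left)
  show "\<bar>inner (A j n v) f\<bar> \<le> norm (D j) * norm f * norm v" for n v
    using Cauchy_Schwarz_ineq2[of "A j n v" f] mult_right_mono[OF norm_A_le[of j n v], of "norm f"]
    by (simp add: mult_ac)
  show "(\<lambda>n. inner (A j n (single x a)) f) \<longlonglongrightarrow> 0" for x a
  proof (rule LIMSEQ_I)
    fix \<epsilon> :: real assume "\<epsilon> > 0"
    \<comment> \<open>The \<open>+ 1\<close> keeps the denominator positive, and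
      \<open>\<delta> * norm b\<close> is at most \<open>\<epsilon> / 2\<close>.\<close>
    define \<delta> where "\<delta> = \<epsilon> / (2 * (norm b + 1))"
    define c where "c = (\<bar>real_of_int (x $ j)\<bar> + \<bar>real_of_int (z $ j)\<bar>) * norm a * norm b"
    have pos: "norm b + 1 > 0" by (simp add: add_nonneg_pos)
    then have "\<delta> > 0" using \<open>\<epsilon> > 0\<close> by (simp add: \<delta>_def)
    then obtain N where N: "\<And>n m. n \<ge> N \<Longrightarrow> m \<ge> N \<Longrightarrow> norm (A j n (single x a) - A j m (single x a)) < \<delta>"
      using A_Cauchy by blast
    have "\<bar>inner (A j n (single x a)) f\<bar> \<le> \<delta> * norm b" if "n \<ge> N" for n
    proof (rule LIMSEQ_le[OF tendsto_rabs[OF lim]])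
      have "(\<lambda>m. \<delta> * norm b + c / real m) \<longlonglongrightarrow> \<delta> * norm b + 0"
        by (intro tendsto_add tendsto_const lim_const_over_n)
      then show "(\<lambda>k. \<delta> * norm b + c / real (r k)) \<longlonglongrightarrow> \<delta> * norm b"
        using LIMSEQ_subseq_LIMSEQ[OF _ r] by (simp add: o_def)
      have "\<bar>inner (A j n (single x a)) (U_pow (r k) (single z b))\<bar> \<le> \<delta> * norm b + c / real (r k)"
        if "k \<ge> N" for k
      proof -
        have "r k \<ge> N" using seq_suble[OF r, of k] that by simp
        then have d: "norm (A j n (single x a) - A j (r k) (single x a)) < \<delta>" using N \<open>n \<ge> N\<close> by blast
        have "\<bar>inner (A j n (single x a) - A j (r k) (single x a)) (U_pow (r k) (single z b))\<bar> \<le> \<delta> * norm b"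
          using Cauchy_Schwarz_ineq2[of "A j n (single x a) - A j (r k) (single x a)" "U_pow (r k) (single z b)"]
            mult_right_mono[OF less_imp_le[OF d], of "norm b"] by simp
        with A_decay[of j "r k" x a z b] show ?thesis
          by (simp add: inner_diff_left c_def)
      qed
      then show "\<exists>K. \<forall>k\<ge>K. \<bar>inner (A j n (single x a)) (U_pow (r k) (single z b))\<bar> \<le> \<delta> * norm b + c / real (r k)"
        by blast
    qed
    moreover have "\<delta> * norm b < \<epsilon>"
    proof -
      have "\<delta> * norm b \<le> \<delta> * (norm b + 1)" using \<open>\<delta> > 0\<close> by simp
      also have "\<dots> = \<epsilon> / 2" using pos by (simp add: \<delta>_def field_simps)
      finally show ?thesis using \<open>\<epsilon> > 0\<close> by simp
    qed
    ultimately show "\<exists>N. \<forall>n\<ge>N. norm (inner (A j n (single x a)) f - 0) < \<epsilon>"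
      by (intro exI[of _ N]) fastforce
  qed
qed

text \<open>The states on which the asymptotic velocity vanishes in every direction.\<close>

definition still :: "(int ^ 'd, 'w) l2 set"
  where "still = {f. \<forall>j v. (\<lambda>n. inner (A j n v) f) \<longlonglongrightarrow> 0}"

lemma subspace_still: "subspace still"
  unfolding subspace_def still_def
  by (auto simp: inner_add_right intro: tendsto_add_zero tendsto_mult_right_zero)

text \<open>\<open>U\<close> carries \<open>orbit j k\<close> to \<open>orbit j (Suc k)\<close>, so
  the commutator telescopes to two boundary terms divided by \<open>n\<close>.\<close>

lemma A_U_commutator: "(\<lambda>n. A j n (U w) - U (A j n w)) \<longlonglongrightarrow> 0"
proof (rule Lim_null_comparison)
  have "U (orbit j k w) = orbit j (Suc k) (U w)" for k
    by (simp add: orbit_Suc conj_U_def)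
  then have "A j n (U w) - U (A j n w) = (1 / real n) *\<^sub>R (\<Sum>k<n. orbit j k (U w) - orbit j (Suc k) (U w))" for n
    by (simp add: A_def blinfun.scaleR_left blinfun.sum_left blinfun.scaleR_right blinfun.sum_right
        sum_subtractf algebra_simps)
  then have "A j n (U w) - U (A j n w) = (1 / real n) *\<^sub>R (orbit j 0 (U w) - orbit j n (U w))" for n
    by (simp only: sum_lessThan_telescope'[of "\<lambda>k. orbit j k (U w)"])
  moreover have "norm (orbit j 0 (U w) - orbit j n (U w)) \<le> 2 * norm (D j) * norm w" for n
    using norm_triangle_ineq4[of "orbit j 0 (U w)" "orbit j n (U w)"]
      norm_orbit_le[of j 0 "U w"] norm_orbit_le[of j n "U w"] by simp
  ultimately show "\<forall>\<^sub>F n in sequentially. norm (A j n (U w) - U (A j n w)) \<le> 2 * norm (D j) * norm w / real n"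
    by (simp add: divide_right_mono)
  show "(\<lambda>n. 2 * norm (D j) * norm w / real n) \<longlonglongrightarrow> 0"
    by (rule lim_const_over_n)
qed

text \<open>Writing \<open>v\<close> as \<open>U (V v)\<close> moves \<open>U\<close> past
  \<open>A j n\<close> at the cost of a commutator that tends to 0; unitarity then cancels
  \<open>U\<close> on both sides.\<close>

lemma still_U:
  assumes "f \<in> still"
  shows "U f \<in> still"
  unfolding still_def mem_Collect_eq
proof (intro allI)
  fix j v
  have "(\<lambda>n. inner (A j n (U (V v)) - U (A j n (V v))) (U f) + inner (A j n (V v)) f) \<longlonglongrightarrow> inner 0 (U f) + 0"
    using assms by (intro tendsto_intros A_U_commutator) (simp add: still_def)
  then show "(\<lambda>n. inner (A j n v) (U f)) \<longlonglongrightarrow> 0"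
    by (simp add: inner_diff_left)
qed

lemma still_V:
  assumes "f \<in> still"
  shows "V f \<in> still"
  unfolding still_def mem_Collect_eq
proof (intro allI)
  fix j v
  have "(\<lambda>n. inner (A j n (U v)) f - inner (A j n (U v) - U (A j n v)) f) \<longlonglongrightarrow> 0 - inner 0 f"
    using assms by (intro tendsto_intros A_U_commutator) (simp add: still_def)
  then show "(\<lambda>n. inner (A j n v) (V f)) \<longlonglongrightarrow> 0"
    by (simp add: inner_diff_left inner_U_left)
qed

lemma still_shift:
  assumes "f \<in> still"
  shows "shift a f \<in> still"
proof -
  have "inner (A j n v) (shift a f) = inner (A j n (shift (- a) v)) f" for j n v
    by (simp add: A_shift inner_shift_left)
  with assms show ?thesis by (simp add: still_def)
qed

lemma still_U_pow: "f \<in> still \<Longrightarrow> U_pow k f \<in> still"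
  by (induction k) (simp_all add: still_U)

lemma still_V_pow: "f \<in> still \<Longrightarrow> V_pow k f \<in> still"
  by (induction k) (simp_all add: still_V)

text \<open>
  A coefficient function \<open>c\<close> on pairs \<open>(a, k)\<close> stands for the polynomial \<open>\<Sum> c (a, k) T\<^sub>a U\<^sup>k\<close>
  in \<open>U\<close> over the group ring of translations.
\<close>

definition pol :: "((int ^ 'd) \<times> nat) set \<Rightarrow> ((int ^ 'd) \<times> nat \<Rightarrow> real) \<Rightarrow> (int ^ 'd, 'w) l2 \<Rightarrow> (int ^ 'd, 'w) l2"
  where "pol F c f = (\<Sum>p\<in>F. c p *\<^sub>R shift (fst p) (U_pow (snd p) f))"

definition pol_adj :: "((int ^ 'd) \<times> nat) set \<Rightarrow> ((int ^ 'd) \<times> nat \<Rightarrow> real) \<Rightarrow> (int ^ 'd, 'w) l2 \<Rightarrow> (int ^ 'd, 'w) l2"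
  where "pol_adj F c f = (\<Sum>p\<in>F. c p *\<^sub>R V_pow (snd p) (shift (- fst p) f))"

lemma inner_pol_left: "inner (pol F c f) g = inner f (pol_adj F c g)"
  by (simp add: pol_def pol_adj_def inner_sum_left inner_sum_right inner_shift_left inner_U_pow_left)

lemma still_pol: "f \<in> still \<Longrightarrow> pol F c f \<in> still"
  unfolding pol_def
  by (intro subspace_sum[OF subspace_still] subspace_scale[OF subspace_still] still_shift still_U_pow)

lemma still_pol_adj: "f \<in> still \<Longrightarrow> pol_adj F c f \<in> still"
  unfolding pol_adj_def
  by (intro subspace_sum[OF subspace_still] subspace_scale[OF subspace_still] still_shift still_V_pow)

text \<open>\<open>still\<close> is invariant under \<open>pol_adj\<close>, so the squared norm of
  \<open>pol_adj F c v\<close> is a matrix element of \<open>pol\<close> on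
  \<open>still\<close>.\<close>

lemma pol_adj_eq_0:
  assumes "\<And>f. f \<in> still \<Longrightarrow> pol F c f = 0" "v \<in> still"
  shows "pol_adj F c v = 0"
proof -
  have "inner (pol_adj F c v) (pol_adj F c v) = inner (pol F c (pol_adj F c v)) v"
    by (simp add: inner_pol_left)
  also have "\<dots> = 0" using assms by (simp add: still_pol_adj)
  finally show ?thesis by simp
qed

section \<open>Commutators of position with polynomials in \<open>U\<close>\<close>

text \<open>The formal identity \<open>[X_j, T_a] = a_j T_a\<close>, read as a weak limit of
  truncations.\<close>

lemma X_shift_commutator_tendsto:
  "(\<lambda>R. inner v (X j R (shift a g) - shift a (X j R g))) \<longlonglongrightarrow> real_of_int (a $ j) * inner v (shift a g)"
proof -
  let ?C = "\<lambda>R. X j R (shift a g) - shift a (X j R g)"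
  have c: "coord (?C R) x = (clamp R (x $ j) - clamp R (x $ j - a $ j)) *\<^sub>R coord g (x - a)" for R x
    by (simp add: scaleR_left_diff_distrib)
  have nb0: "norm (?C R) \<le> \<bar>real_of_int (a $ j)\<bar> * norm (shift a g)" for R
    by (rule norm_l2_le) (simp_all only: c norm_scaleR coord_shift mult_right_mono[OF clamp_diff_le] norm_ge_zero abs_ge_zero)
  have nb: "norm (?C R - real_of_int (a $ j) *\<^sub>R shift a g) \<le> 2 * \<bar>real_of_int (a $ j)\<bar> * norm g" for R
    using norm_triangle_ineq4[of "?C R" "real_of_int (a $ j) *\<^sub>R shift a g"] nb0[of R] by simp
  have "(\<lambda>R. inner v (?C R - real_of_int (a $ j) *\<^sub>R shift a g)) \<longlonglongrightarrow> 0"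
  proof (rule tendsto_0_if_singles[where \<phi>="\<lambda>R v. inner v (?C R - real_of_int (a $ j) *\<^sub>R shift a g)"
        and C="2 * \<bar>real_of_int (a $ j)\<bar> * norm g"])
    show "linear (\<lambda>v. inner v (?C R - real_of_int (a $ j) *\<^sub>R shift a g))" for R
      by (intro linearI) (simp_all add: inner_add_left)
    show "\<bar>inner v (?C R - real_of_int (a $ j) *\<^sub>R shift a g)\<bar> \<le> 2 * \<bar>real_of_int (a $ j)\<bar> * norm g * norm v" for R v
      using order_trans[OF Cauchy_Schwarz_ineq2 mult_left_mono[OF nb norm_ge_zero], of v R] by (simp only: mult_ac)
    show "(\<lambda>R. inner (single x w) (?C R - real_of_int (a $ j) *\<^sub>R shift a g)) \<longlonglongrightarrow> 0" for x w
    proof (rule tendsto_eventually)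
      show "\<forall>\<^sub>F R in sequentially. inner (single x w) (?C R - real_of_int (a $ j) *\<^sub>R shift a g) = 0"
        unfolding eventually_sequentially
      proof (intro exI allI impI)
        fix R assume R: "nat \<bar>x $ j\<bar> + nat \<bar>a $ j\<bar> \<le> R"
        then have "\<bar>x $ j\<bar> \<le> int R" "\<bar>x $ j - a $ j\<bar> \<le> int R" by auto
        then show "inner (single x w) (?C R - real_of_int (a $ j) *\<^sub>R shift a g) = 0"
          by (simp add: clamp_eq flip: scaleR_left_diff_distrib)
      qed
    qed
  qed
  then show ?thesis by (simp add: inner_diff_right LIM_zero_cancel)
qed

lemma U_pow_V_pow_commute: "U_pow k (V_pow l f) = V_pow l (U_pow k f)"
proof -
  have "U_pow k (V g) = V (U_pow k g)" for g
    by (induction k) simp_all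
  then show ?thesis by (induction l) simp_all
qed

lemma U_pow_orbit_V_pow: "U_pow l (orbit j i (V_pow l f)) = orbit j (i + l) f"
proof -
  have "U_pow l (U_pow i g) = U_pow (i + l) g" for g
    using funpow_add[of l i "blinfun_apply U"] by (simp add: add.commute)
  moreover have "V_pow (Suc i) (V_pow l f) = V_pow (Suc (i + l)) f"
    using funpow_add[of "Suc i" l "blinfun_apply V"] by (simp del: funpow.simps)
  ultimately show ?thesis by (simp only: orbit_apply)
qed

lemma U_pow_A_V_pow: "U_pow i (A j n (V_pow i f)) = (1 / real n) *\<^sub>R (\<Sum>l<n. orbit j (i + l) f)"
proof -
  have "U_pow i (A j n (V_pow i f)) = (1 / real n) *\<^sub>R (\<Sum>l<n. U_pow i (orbit j l (V_pow i f)))"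
    by (simp add: A_def blinfun.scaleR_left blinfun.sum_left linear_scale[OF linear_U_pow] linear_sum[OF linear_U_pow])
  then show ?thesis by (simp add: U_pow_orbit_V_pow add.commute)
qed

text \<open>On \<open>still\<close> the commutator of position with the relation has vanishing
  matrix elements. By the Leibniz rule it is the differentiated relation plus displacement terms,
  and averaging over conjugations by \<open>U\<close> turns the latter into velocities, which
  vanish.\<close>

lemma annihilator_derivative:
  assumes fin: "finite F" and ann: "\<And>f. f \<in> still \<Longrightarrow> pol F c f = 0" and f: "f \<in> still"
  shows "pol F (\<lambda>p. real_of_int (fst p $ j) * c p) f = 0"
proof -
  have star: "(\<Sum>p\<in>F. c p * (real_of_int (fst p $ j) * inner v (shift (fst p) (U_pow (snd p) f))
      + inner (shift (- fst p) v) (\<Sum>i<snd p. orbit j i (U_pow (snd p) f)))) = 0"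
    if v: "v \<in> still" and f: "f \<in> still" for v f
  proof -
    \<comment> \<open>Leibniz rule for the commutator of \<open>X j R\<close> with each monomial.
      The product of \<open>V_pow\<close> and \<open>U_pow\<close> is left unreduced to fit
      \<open>sum_orbit_tendsto\<close>.\<close>
    let ?T = "\<lambda>R p. c p * (inner v (X j R (shift (fst p) (U_pow (snd p) f)) - shift (fst p) (X j R (U_pow (snd p) f)))
       + inner (shift (- fst p) v)
           (X j R (U_pow (snd p) f) - U_pow (snd p) (X j R (V_pow (snd p) (U_pow (snd p) f)))))"
    have "?T R p = c p * (inner v (X j R (shift (fst p) (U_pow (snd p) f)))
        - inner v (shift (fst p) (U_pow (snd p) (X j R f))))" for R p
      by (simp add: inner_diff_right inner_shift_left)
    then have "(\<Sum>p\<in>F. ?T R p) = inner v (X j R (pol F c f)) - inner v (pol F c (X j R f))" for R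
      by (simp add: pol_def blinfun.sum_right blinfun.scaleR_right inner_sum_right sum_subtractf right_diff_distrib)
    \<comment> \<open>\<open>X j R f\<close> need not lie in \<open>still\<close>, so the relation
      is applied to \<open>v\<close> through the adjoint.\<close>
    moreover have "inner v (pol F c (X j R f)) = 0" for R
      using pol_adj_eq_0[OF ann v] by (simp add: inner_commute[of v] inner_pol_left)
    ultimately have zero: "(\<Sum>p\<in>F. ?T R p) = 0" for R
      using ann[OF f] by simp
    have "(\<lambda>R. \<Sum>p\<in>F. ?T R p) \<longlonglongrightarrow> (\<Sum>p\<in>F. c p * (real_of_int (fst p $ j) * inner v (shift (fst p) (U_pow (snd p) f))
      + inner (shift (- fst p) v) (\<Sum>i<snd p. orbit j i (U_pow (snd p) f))))"
      by (intro tendsto_sum tendsto_mult tendsto_add tendsto_const X_shift_commutator_tendsto sum_orbit_tendsto)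
    then show ?thesis unfolding zero by (simp add: LIMSEQ_const_iff)
  qed
  have orth: "inner v (pol F (\<lambda>p. real_of_int (fst p $ j) * c p) f) = 0" if v: "v \<in> still" for v
  proof -
    let ?a = "\<lambda>p. real_of_int (fst p $ j) * inner v (shift (fst p) (U_pow (snd p) f))"
    let ?g = "\<lambda>p. U_pow (snd p) f"
    \<comment> \<open>Passing from \<open>v\<close> and \<open>f\<close> to \<open>V_pow l v\<close>
      and \<open>V_pow l f\<close> preserves the first term and raises the index of each
      displacement term by \<open>l\<close>.\<close>
    have "(\<Sum>p\<in>F. c p * (?a p + (\<Sum>i<snd p. inner (shift (- fst p) v) (orbit j (i + l) (?g p))))) = 0" for l
    proof -
      have comm: "U_pow k (V_pow l f) = V_pow l (U_pow k f)" for k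
        by (rule U_pow_V_pow_commute)
      have 1: "inner (V_pow l v) (shift a (U_pow k (V_pow l f))) = inner v (shift a (U_pow k f))" for a k
        by (simp add: comm inner_V_pow_left flip: V_pow_shift)
      have 2: "inner (shift a (V_pow l v)) (orbit j i (U_pow k (V_pow l f))) = inner (shift a v) (orbit j (i + l) (U_pow k f))"
        for a k i
        by (simp add: comm inner_V_pow_left U_pow_orbit_V_pow flip: V_pow_shift)
      show ?thesis
        using star[OF still_V_pow[OF v, of l] still_V_pow[OF f, of l]] by (simp only: inner_sum_right 1 2)
    qed
    then have "(\<Sum>l<n. \<Sum>p\<in>F. c p * (?a p + (\<Sum>i<snd p. inner (shift (- fst p) v) (orbit j (i + l) (?g p))))) = 0" for n
      by simp
    moreover have "(\<Sum>l<n. c p * (?a p + (\<Sum>i<snd p. inner (shift (- fst p) v) (orbit j (i + l) (?g p)))))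
        = c p * (real n * ?a p + (\<Sum>i<snd p. \<Sum>l<n. inner (shift (- fst p) v) (orbit j (i + l) (?g p))))" for n p
      by (subst sum.swap) (simp add: sum.distrib flip: sum_distrib_left)
    ultimately have eq: "(\<Sum>p\<in>F. c p * (real n * ?a p
        + (\<Sum>i<snd p. \<Sum>l<n. inner (shift (- fst p) v) (orbit j (i + l) (?g p))))) = 0" for n
      by (subst (asm) sum.swap) simp
    \<comment> \<open>Averaging over \<open>l < n\<close> turns the displacement terms into
      conjugates of \<open>A j n\<close>.\<close>
    have "(\<Sum>p\<in>F. c p * (?a p + (\<Sum>i<snd p. inner (shift (- fst p) v) (U_pow i (A j n (V_pow i (?g p))))))) = 0"
      if "n > 0" for n
    proof -
      have "(\<Sum>p\<in>F. c p * (?a p + (\<Sum>i<snd p. inner (shift (- fst p) v) (U_pow i (A j n (V_pow i (?g p)))))))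
        = (1 / real n) * (\<Sum>p\<in>F. c p * (real n * ?a p
        + (\<Sum>i<snd p. \<Sum>l<n. inner (shift (- fst p) v) (orbit j (i + l) (?g p)))))"
        unfolding sum_distrib_left[of "1 / real n"]
        using that by (intro sum.cong refl)
          (simp add: U_pow_A_V_pow inner_sum_right sum_distrib_left distrib_left)
      then show ?thesis by (simp only: eq mult_zero_right)
    qed
    then have "\<forall>\<^sub>F n in sequentially. (\<Sum>p\<in>F. c p * (?a p
        + (\<Sum>i<snd p. inner (shift (- fst p) v) (U_pow i (A j n (V_pow i (?g p))))))) = 0"
      by (intro eventually_sequentiallyI[of 1]) auto
    from tendsto_eventually[OF this]
    have l0: "(\<lambda>n. \<Sum>p\<in>F. c p * (?a p
        + (\<Sum>i<snd p. inner (shift (- fst p) v) (U_pow i (A j n (V_pow i (?g p))))))) \<longlonglongrightarrow> 0" .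
    have "(\<lambda>n. inner (shift (- a) v) (U_pow i (A j n (V_pow i g)))) \<longlonglongrightarrow> 0" for a i g
    proof -
      have "V_pow i (shift (- a) v) \<in> still" by (intro still_V_pow still_shift v)
      then have "(\<lambda>n. inner (A j n (V_pow i g)) (V_pow i (shift (- a) v))) \<longlonglongrightarrow> 0"
        by (simp add: still_def)
      then show ?thesis by (simp only: inner_commute[of _ "V_pow i (shift (- a) v)"] inner_V_pow_left)
    qed
    then have "(\<lambda>n. \<Sum>p\<in>F. c p * (?a p
        + (\<Sum>i<snd p. inner (shift (- fst p) v) (U_pow i (A j n (V_pow i (?g p)))))))
        \<longlonglongrightarrow> (\<Sum>p\<in>F. c p * (?a p + (\<Sum>i<snd p. 0)))"
      by (intro tendsto_sum tendsto_mult tendsto_add tendsto_const)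
    from LIMSEQ_unique[OF this l0] have "(\<Sum>p\<in>F. c p * ?a p) = 0" by simp
    then show ?thesis by (simp add: pol_def inner_sum_right mult_ac)
  qed
  \<comment> \<open>The vector to be shown zero lies in \<open>still\<close>, hence is orthogonal to
    itself.\<close>
  from orth[OF still_pol[OF f, of F "\<lambda>p. real_of_int (fst p $ j) * c p"]] show ?thesis
    by (simp only: inner_eq_zero_iff)
qed

section \<open>Polynomial relations\<close>

text \<open>Matrix units at displacements in \<open>B\<close>. For finite \<open>B\<close> their
  number bounds the dimension of the space in which the linear relation is sought.\<close>

definition elementary :: "(int ^ 'd) set \<Rightarrow> ((int ^ 'd, 'w) l2 \<Rightarrow>\<^sub>L (int ^ 'd, 'w) l2) set"
  where "elementary B = (\<lambda>(x, e, e'). shift x o\<^sub>L fibre_op (rank_one e e')) ` (B \<times> E \<times> E)"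

lemma elementaryI:
  "x \<in> B \<Longrightarrow> e \<in> E \<Longrightarrow> e' \<in> E \<Longrightarrow> shift x o\<^sub>L fibre_op (rank_one e e') \<in> elementary B"
  unfolding elementary_def by (rule image_eqI[where x="(x, e, e')"]) auto

lemma shift_fibre_op_in_span:
  assumes "x \<in> B"
  shows "shift x o\<^sub>L fibre_op g \<in> span (elementary B)"
proof -
  have g: "g w = (\<Sum>e\<in>E. \<Sum>e'\<in>E. inner (g e) e' *\<^sub>R rank_one e e' w)" for w
  proof -
    have "g w = g (\<Sum>e\<in>E. inner w e *\<^sub>R e)" using frame by (simp add: tight_frame_def)
    also have "\<dots> = (\<Sum>e\<in>E. inner w e *\<^sub>R g e)" by (simp add: blinfun.sum_right blinfun.scaleR_right)
    also have "\<dots> = (\<Sum>e\<in>E. inner w e *\<^sub>R (\<Sum>e'\<in>E. inner (g e) e' *\<^sub>R e'))"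
      using frame by (simp add: tight_frame_def)
    finally show ?thesis by (simp add: scaleR_sum_right mult.commute)
  qed
  have "shift x o\<^sub>L fibre_op g = (\<Sum>e\<in>E. \<Sum>e'\<in>E. inner (g e) e' *\<^sub>R (shift x o\<^sub>L fibre_op (rank_one e e')))"
    by (rule blinfun_eqI, rule l2_eqI) (simp add: blinfun.sum_left blinfun.scaleR_left, subst g, simp)
  also have "\<dots> \<in> span (elementary B)"
    using assms by (intro span_sum span_scale span_base elementaryI)
  finally show ?thesis .
qed

text \<open>One application of \<open>U\<close> moves by at most \<open>r\<close> in each
  coordinate.\<close>

lemma U_compose_in_span:
  assumes S: "S \<subseteq> lattice_box r" and B: "B \<in> span (elementary (lattice_box L))"
  shows "U o\<^sub>L B \<in> span (elementary (lattice_box (L + r)))"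
  using B
proof (induction rule: span_induct_alt)
  case base
  show ?case by (simp add: span_zero)
next
  case (step c C B)
  from step(1) obtain x e e' where x: "x \<in> lattice_box L" and C: "C = shift x o\<^sub>L fibre_op (rank_one e e')"
    by (auto simp: elementary_def)
  have "U o\<^sub>L C = (\<Sum>t\<in>S. shift (t + x) o\<^sub>L fibre_op (u t o\<^sub>L rank_one e e'))"
    by (rule blinfun_eqI, rule l2_eqI) (simp add: C coord_U blinfun.sum_left diff_diff_eq)
  moreover have "t + x \<in> lattice_box (L + r)" if "t \<in> S" for t
    using S x that by (intro lattice_box_add) auto
  ultimately have "U o\<^sub>L C \<in> span (elementary (lattice_box (L + r)))"
    by (auto intro!: span_sum shift_fibre_op_in_span)
  moreover have "U o\<^sub>L (c *\<^sub>R C + B) = c *\<^sub>R (U o\<^sub>L C) + (U o\<^sub>L B)"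
    by (rule blinfun_eqI) (simp add: blinfun.bilinear_simps)
  ultimately show ?case using step(2) by (simp add: span_add span_scale)
qed

lemma shift_compose_in_span:
  assumes a: "a \<in> lattice_box M" and B: "B \<in> span (elementary (lattice_box L))"
  shows "shift a o\<^sub>L B \<in> span (elementary (lattice_box (L + M)))"
  using B
proof (induction rule: span_induct_alt)
  case base
  show ?case by (simp add: span_zero)
next
  case (step c C B)
  from step(1) obtain x e e' where x: "x \<in> lattice_box L" and C: "C = shift x o\<^sub>L fibre_op (rank_one e e')"
    by (auto simp: elementary_def)
  have "shift a o\<^sub>L C = shift (a + x) o\<^sub>L fibre_op (rank_one e e')"
    by (rule blinfun_eqI) (simp add: C)
  moreover have "a + x \<in> lattice_box (L + M)"
    using a x by (rule lattice_box_add)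
  ultimately have "shift a o\<^sub>L C \<in> span (elementary (lattice_box (L + M)))"
    by (simp add: shift_fibre_op_in_span)
  moreover have "shift a o\<^sub>L (c *\<^sub>R C + B) = c *\<^sub>R (shift a o\<^sub>L C) + (shift a o\<^sub>L B)"
    by (rule blinfun_eqI) (simp add: blinfun.bilinear_simps)
  ultimately show ?case using step(2) by (simp add: span_add span_scale)
qed

text \<open>
  The monomials \<open>T\<^sub>a U\<^sup>k\<close> with \<open>a\<close> in a box of side \<open>\<sim> K\<close> and \<open>k \<le> K\<close> are of order \<open>K\<^sup>d\<^sup>+\<^sup>1\<close> in
  number, but lie in a space of dimension of order \<open>K\<^sup>d\<close>.
\<close>

lemma annihilating_polynomial_exists:
  obtains F c where "finite F" "\<exists>p\<in>F. c p \<noteq> 0" "\<And>f. pol F c f = 0"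
proof -
  define r where "r = (\<Sum>t\<in>S. \<Sum>i\<in>UNIV. nat \<bar>t $ i\<bar>)"
  have S: "S \<subseteq> lattice_box r"
  proof
    fix t assume t: "t \<in> S"
    have "nat \<bar>t $ i\<bar> \<le> r" for i
    proof -
      have "nat \<bar>t $ i\<bar> \<le> (\<Sum>i\<in>UNIV. nat \<bar>t $ i\<bar>)" by (rule member_le_sum) auto
      also have "\<dots> \<le> r" unfolding r_def by (rule member_le_sum[OF t _ finite_S]) simp
      finally show ?thesis .
    qed
    then show "t \<in> lattice_box r" by (simp add: lattice_box_def nat_le_iff)
  qed
  let ?pow = "\<lambda>k. (((o\<^sub>L) U) ^^ k) id_blinfun"
  have pow: "?pow k \<in> span (elementary (lattice_box (k * r)))" for k
  proof (induction k)
    case 0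
    have "(id_blinfun :: (int ^ 'd, 'w) l2 \<Rightarrow>\<^sub>L (int ^ 'd, 'w) l2) = shift 0 o\<^sub>L fibre_op id_blinfun"
      by (rule blinfun_eqI, rule l2_eqI) simp
    also have "\<dots> \<in> span (elementary (lattice_box (0 * r)))"
      by (rule shift_fibre_op_in_span) (simp add: lattice_box_def)
    finally show ?case by (simp only: funpow_0)
  next
    case (Suc k)
    from U_compose_in_span[OF S Suc] show ?case by (simp add: add.commute)
  qed
  define m where "m = card E * card E"
  \<comment> \<open>\<open>m\<close> bounds the number of matrix units per displacement. With this
    \<open>K\<close>, \<open>(4 * L + 1) ^ CARD('d) * m\<close> is at most
    \<open>(2 * L + 1) ^ CARD('d) * K\<close>, just below the number of monomials, which has
    \<open>K + 1\<close> for \<open>K\<close>.\<close>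
  define K where "K = 2 ^ CARD('d) * m"
  \<comment> \<open>Powers up to \<open>K\<close> move by at most \<open>L\<close>, and so do the
    translations; hence the box of radius \<open>L + L\<close>.\<close>
  define L where "L = K * r"
  define F :: "((int ^ 'd) \<times> nat) set" where "F = lattice_box L \<times> {..K}"
  define v where "v p = shift (fst p) o\<^sub>L ?pow (snd p)" for p :: "(int ^ 'd) \<times> nat"
  define Y where "Y = elementary (lattice_box (L + L))"
  have "v p \<in> span Y" if "p \<in> F" for p
  proof -
    have "v p \<in> span (elementary (lattice_box (snd p * r + L)))"
      unfolding v_def using that by (intro shift_compose_in_span pow) (auto simp: F_def)
    moreover have "snd p * r + L \<le> L + L" using that by (auto simp: F_def L_def)
    then have "(lattice_box (snd p * r + L) :: (int ^ 'd) set) \<subseteq> lattice_box (L + L)"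
      by (rule lattice_box_mono)
    then have "elementary (lattice_box (snd p * r + L)) \<subseteq> Y"
      unfolding Y_def elementary_def by (intro image_mono Sigma_mono) auto
    ultimately show ?thesis using span_mono by blast
  qed
  then have "v ` F \<subseteq> span Y" by auto
  moreover have fin: "finite F" by (simp add: F_def finite_lattice_box)
  moreover have "finite Y" by (simp add: Y_def elementary_def finite_lattice_box finite_E)
  moreover have "card Y < card F"
  proof -
    have "card Y \<le> card (lattice_box (L + L) \<times> E \<times> E :: ((int ^ 'd) \<times> 'w \<times> 'w) set)"
      unfolding Y_def elementary_def by (rule card_image_le) (simp add: finite_lattice_box finite_E)
    also have "\<dots> = (4 * L + 1) ^ CARD('d) * m"
      by (simp add: card_cartesian_product card_lattice_box m_def)
    also have "\<dots> \<le> (2 * (2 * L + 1)) ^ CARD('d) * m"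
      by (intro mult_right_mono power_mono) auto
    also have "\<dots> = (2 * L + 1) ^ CARD('d) * K"
      by (simp only: power_mult_distrib K_def mult_ac)
    also have "\<dots> < (2 * L + 1) ^ CARD('d) * Suc K" by simp
    also have "\<dots> = card F" by (simp add: F_def card_cartesian_product card_lattice_box)
    finally show ?thesis .
  qed
  ultimately obtain c where c: "\<exists>p\<in>F. c p \<noteq> 0" "(\<Sum>p\<in>F. c p *\<^sub>R v p) = 0"
    by - (rule linear_relation_if_card_less)
  have "pol F c f = (\<Sum>p\<in>F. c p *\<^sub>R v p) f" for f
    by (simp add: pol_def v_def blinfun.sum_left blinfun.scaleR_left funpow_blinfun_compose)
  then have "pol F c f = 0" for f by (simp add: c(2))
  with fin c(1) show thesis by (rule that)
qed

text \<open>
  The coordinate derivations act on coefficients by \<open>c (a, k) \<mapsto> a\<^sub>j c (a, k)\<close>; linear combinations with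
  the identity kill one translation \<open>a\<close> at a time, until a single one is left.
\<close>

lemma annihilating_polynomial_single_translation:
  assumes fin: "finite F" and "\<exists>p\<in>F. c p \<noteq> 0" "\<And>f. f \<in> still \<Longrightarrow> pol F c f = 0"
  obtains c' a where "\<exists>p\<in>F. c' p \<noteq> 0" "\<And>f. f \<in> still \<Longrightarrow> pol F c' f = 0"
    "\<And>p. p \<in> F \<Longrightarrow> c' p \<noteq> 0 \<Longrightarrow> fst p = a"
proof -
  define supp where "supp c = fst ` {p\<in>F. c p \<noteq> 0}" for c :: "_ \<Rightarrow> real"
  have "\<exists>c' a. (\<exists>p\<in>F. c' p \<noteq> 0) \<and> (\<forall>f\<in>still. pol F c' f = 0) \<and> (\<forall>p\<in>F. c' p \<noteq> 0 \<longrightarrow> fst p = a)"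
    using assms(2,3)
  proof (induction "card (supp c)" arbitrary: c rule: less_induct)
    case less
    show ?case
    proof (cases "\<exists>a. \<forall>p\<in>F. c p \<noteq> 0 \<longrightarrow> fst p = a")
      case True
      with less.prems show ?thesis by blast
    next
      case False
      from less.prems(1) obtain p where p: "p \<in> F" "c p \<noteq> 0" by blast
      with False obtain q where q: "q \<in> F" "c q \<noteq> 0" "fst q \<noteq> fst p" by blast
      then obtain j where j: "fst q $ j \<noteq> fst p $ j" by (auto simp: vec_eq_iff)
      \<comment> \<open>The \<open>j\<close>-th derivation minus \<open>fst p $ j\<close> times the
        identity removes the translation \<open>fst p\<close>, while the coefficient at
        \<open>q\<close> survives and keeps the relation nontrivial.\<close>
      define c' where "c' s = real_of_int (fst s $ j) * c s - real_of_int (fst p $ j) * c s" for s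
      have "supp c' \<subseteq> supp c" "fst p \<notin> supp c'" "fst p \<in> supp c"
        using p by (auto simp: supp_def c'_def)
      moreover have "finite (supp c)" using fin by (simp add: supp_def)
      ultimately have "card (supp c') < card (supp c)" by (intro psubset_card_mono) auto
      moreover have "c' q \<noteq> 0" using q j by (simp add: c'_def)
      then have "\<exists>p\<in>F. c' p \<noteq> 0" using q(1) by blast
      moreover have "pol F c' f = 0" if f: "f \<in> still" for f
      proof -
        have "pol F c' f = pol F (\<lambda>s. real_of_int (fst s $ j) * c s) f - real_of_int (fst p $ j) *\<^sub>R pol F c f"
          by (simp add: pol_def c'_def scaleR_left_diff_distrib sum_subtractf scaleR_sum_right)
        then show ?thesis using annihilator_derivative[OF fin less.prems(2) f] less.prems(2)[OF f] by simp
      qed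
      ultimately show ?thesis by (rule less.hyps)
    qed
  qed
  then show thesis using that by blast
qed

text \<open>A single remaining translation is cancelled by its inverse, which leaves scalar
  coefficients.\<close>

lemma still_polynomial_relation:
  obtains q :: "real poly" where "q \<noteq> 0" "\<And>f. f \<in> still \<Longrightarrow> (\<Sum>k\<le>degree q. coeff q k *\<^sub>R U_pow k f) = 0"
proof -
  obtain F c0 where F: "finite F" "\<exists>p\<in>F. c0 p \<noteq> 0" "\<And>f. pol F c0 f = 0"
    using annihilating_polynomial_exists by blast
  obtain c a where c: "\<exists>p\<in>F. c p \<noteq> 0" "\<And>f. f \<in> still \<Longrightarrow> pol F c f = 0"
      "\<And>p. p \<in> F \<Longrightarrow> c p \<noteq> 0 \<Longrightarrow> fst p = a"
    using annihilating_polynomial_single_translation[OF F(1,2)] F(3) by blast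
  define G where "G = snd ` {p\<in>F. c p \<noteq> 0}"
  \<comment> \<open>Only exponents in \<open>G\<close> are kept, as the values of \<open>c\<close>
    outside \<open>F\<close> are unconstrained.\<close>
  define q where "q = (\<Sum>k\<in>G. monom (c (a, k)) k)"
  have fin: "finite G" using F(1) by (simp add: G_def)
  have coeff: "coeff q k = (if k \<in> G then c (a, k) else 0)" for k
    using fin by (simp add: q_def coeff_sum sum.delta)
  have supp: "{p\<in>F. c p \<noteq> 0} = Pair a ` G"
    using c(3) by (force simp: G_def)
  have G0: "c (a, k) \<noteq> 0" if "k \<in> G" for k
    using supp that by blast
  have "q \<noteq> 0"
  proof -
    obtain k where "k \<in> G" using c(1) by (auto simp: G_def)
    then have "coeff q k \<noteq> 0" using G0 by (simp add: coeff)
    then show ?thesis by auto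
  qed
  moreover have "(\<Sum>k\<le>degree q. coeff q k *\<^sub>R U_pow k f) = 0" if "f \<in> still" for f
  proof -
    have "pol F c f = (\<Sum>p\<in>{p\<in>F. c p \<noteq> 0}. c p *\<^sub>R shift (fst p) (U_pow (snd p) f))"
      unfolding pol_def using F(1) by (intro sum.mono_neutral_right) auto
    also have "\<dots> = (\<Sum>k\<in>G. c (a, k) *\<^sub>R shift a (U_pow k f))"
      unfolding supp by (subst sum.reindex) (auto simp: inj_on_def)
    also have "\<dots> = shift a (\<Sum>k\<in>G. coeff q k *\<^sub>R U_pow k f)"
      by (simp add: coeff blinfun.sum_right blinfun.scaleR_right)
    finally have "shift (- a) (shift a (\<Sum>k\<in>G. coeff q k *\<^sub>R U_pow k f)) = 0"
      using c(2)[OF that] by simp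
    then have "(\<Sum>k\<in>G. coeff q k *\<^sub>R U_pow k f) = 0" by simp
    moreover have "(\<Sum>k\<in>G. coeff q k *\<^sub>R U_pow k f) = (\<Sum>k\<le>degree q. coeff q k *\<^sub>R U_pow k f)"
    proof (rule sum.mono_neutral_left)
      show "G \<subseteq> {..degree q}" using G0 by (auto simp: coeff intro!: le_degree)
    qed (auto simp: coeff)
    ultimately show ?thesis by simp
  qed
  ultimately show thesis by (rule that)
qed

section \<open>Decay of orbits\<close>

text \<open>A one-site orbit not tending weakly to 0 would have a nonzero weak limit point in
  \<open>still\<close>. Density extends the decay to all \<open>g\<close>, and the finite frame
  turns it into convergence of each coordinate.\<close>

lemma decay_if_still_trivial:
  fixes g :: "(int ^ 'd, 'w) l2"
  assumes still: "still = {0}"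
  shows "(\<lambda>n. coord (U_pow n g) x) \<longlonglongrightarrow> 0"
proof -
  have weak: "(\<lambda>n. inner (U_pow n (single z b)) v) \<longlonglongrightarrow> 0" for z b v
  proof (rule ccontr)
    assume "\<not> ?thesis"
    then obtain \<epsilon> where \<epsilon>: "\<epsilon> > 0" "\<And>N. \<exists>n\<ge>N. \<bar>inner (U_pow n (single z b)) v\<bar> \<ge> \<epsilon>"
      by (auto simp: LIMSEQ_def dist_real_def not_less)
    \<comment> \<open>\<open>s\<close> enumerates the times at which the matrix element is at least
      \<open>\<epsilon>\<close> in absolute value, so the weak limit along a subsequence cannot be
      0.\<close>
    define s where "s = enumerate {n. \<bar>inner (U_pow n (single z b)) v\<bar> \<ge> \<epsilon>}"
    have inf: "infinite {n. \<bar>inner (U_pow n (single z b)) v\<bar> \<ge> \<epsilon>}"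
      unfolding infinite_nat_iff_unbounded_le using \<epsilon>(2) by blast
    have s: "strict_mono s" "\<And>k. \<bar>inner (U_pow (s k) (single z b)) v\<bar> \<ge> \<epsilon>"
      using strict_mono_enumerate[OF inf] enumerate_in_set[OF inf] by (auto simp: s_def)
    obtain r f where r: "strict_mono r"
      and lim: "\<And>w. (\<lambda>k. inner w (U_pow (s (r k)) (single z b))) \<longlonglongrightarrow> inner w f"
      using weakly_convergent_subsequence[OF frame, of "\<lambda>k. U_pow (s k) (single z b)" "norm b"] by auto
    have "f \<in> still"
      unfolding still_def
      using weak_limit_has_no_velocity[OF strict_mono_o[OF s(1) r], of z b f] lim by simp
    then have "(\<lambda>k. inner v (U_pow (s (r k)) (single z b))) \<longlonglongrightarrow> 0"
      using lim[of v] still by simp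
    from LIMSEQ_D[OF this \<epsilon>(1)] obtain k where "\<bar>inner v (U_pow (s (r k)) (single z b))\<bar> < \<epsilon>"
      by auto
    with s(2)[of "r k"] show False by (simp add: inner_commute)
  qed
  have weak: "(\<lambda>n. inner (U_pow n g) v) \<longlonglongrightarrow> 0" for v
  proof (rule tendsto_0_if_singles[where \<phi>="\<lambda>n g. inner (U_pow n g) v" and C="norm v"])
    show "linear (\<lambda>g. inner (U_pow n g) v)" for n
      by (intro linearI) (simp_all add: linear_add[OF linear_U_pow] linear_scale[OF linear_U_pow] inner_add_left)
    show "\<bar>inner (U_pow n f) v\<bar> \<le> norm v * norm f" for n f
      using Cauchy_Schwarz_ineq2[of "U_pow n f" v] by (simp add: mult.commute)
  qed (rule weak)
  have "(\<lambda>n. \<Sum>e\<in>E. inner (coord (U_pow n g) x) e *\<^sub>R e) \<longlonglongrightarrow> (\<Sum>e\<in>E. 0 *\<^sub>R e)"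
    using weak[of "single x _"] by (intro tendsto_intros) simp
  then show ?thesis using frame by (simp add: tight_frame_def)
qed

end

section \<open>Eigenvalues and localization\<close>

text \<open>Split off a root: \<open>p(T) = (T - z) q(T)\<close>. Either \<open>q(T) f\<close> is an
  eigenvector, or \<open>q\<close> gives a relation of smaller degree.\<close>

lemma complex_polynomial_relation_eigenvector:
  fixes scale :: "complex \<Rightarrow> 'a::ab_group_add \<Rightarrow> 'a"
  assumes vs: "vector_space scale" and T: "Vector_Spaces.linear scale scale T"
    and "p \<noteq> 0" "f \<noteq> 0" "(\<Sum>k\<le>degree p. scale (coeff p k) ((T ^^ k) f)) = 0"
  shows "\<exists>a g. g \<noteq> 0 \<and> T g = scale a g"
  using assms(3-5)
proof (induction "degree p" arbitrary: p rule: less_induct)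
  case less
  interpret vector_space scale by (rule vs)
  interpret T: Vector_Spaces.linear scale scale T by (rule T)
  show ?case
  proof (cases "degree p = 0")
    case True
    then have "coeff p 0 \<noteq> 0" using less.prems(1) by (metis leading_coeff_0_iff)
    with True less.prems show ?thesis by simp
  next
    case False
    then have "\<not> constant (poly p)" by (simp add: constant_degree)
    then obtain z where "poly p z = 0" using fundamental_theorem_of_algebra by blast
    then obtain q where p: "p = [:- z, 1:] * q" by (auto simp: poly_eq_0_iff_dvd)
    with less.prems(1) have q: "q \<noteq> 0" by auto
    then have deg: "degree p = Suc (degree q)" unfolding p by (subst degree_mult_eq) auto
    define g where "g = (\<Sum>k\<le>degree q. scale (coeff q k) ((T ^^ k) f))"
    have p': "p = pCons 0 q - smult z q" by (simp add: p)
    have "(\<Sum>k\<le>degree p. scale (coeff p k) ((T ^^ k) f))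
        = (\<Sum>k\<le>Suc (degree q). scale (coeff (pCons 0 q) k) ((T ^^ k) f))
          - (\<Sum>k\<le>Suc (degree q). scale (z * coeff q k) ((T ^^ k) f))"
      unfolding deg by (simp only: p' coeff_diff coeff_smult scale_left_diff_distrib sum_subtractf)
    also have "(\<Sum>k\<le>Suc (degree q). scale (coeff (pCons 0 q) k) ((T ^^ k) f)) = T g"
      unfolding sum.atMost_Suc_shift by (simp add: g_def T.sum T.scale)
    also have "(\<Sum>k\<le>Suc (degree q). scale (z * coeff q k) ((T ^^ k) f)) = scale z g"
      by (simp add: g_def scale_sum_right coeff_eq_0)
    finally have "T g = scale z g" using less.prems(3) by simp
    then show ?thesis
      using less.hyps[of q] deg q less.prems(2) by (cases "g = 0") (auto simp: g_def)
  qed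
qed

section \<open>Complex scalars and the passage to \<open>ell2\<close>\<close>

lemma norm_scaleC: "norm (c *\<^sub>C x) = cmod c * norm (x :: 'w::complex_inner)"
proof -
  have "cinner (c *\<^sub>C x) (c *\<^sub>C x) = c * cnj (c * cinner x x)"
    by (metis cinner_commute cinner_scaleC_left)
  also have "\<dots> = complex_of_real ((cmod c)\<^sup>2) * cinner x x"
    by (metis cinner_commute complex_cnj_mult complex_norm_square mult.assoc)
  finally have "(norm (c *\<^sub>C x))\<^sup>2 = (cmod c * norm x)\<^sup>2"
    by (simp add: power2_norm_eq_inner inner_eq_Re_cinner power_mult_distrib)
  then show ?thesis by (simp add: power2_eq_iff_nonneg)
qed

lemma cinner_self: "cinner x x = complex_of_real ((norm (x :: 'w::complex_inner))\<^sup>2)"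
proof -
  have "Im (cinner x x) = 0"
    using arg_cong[OF cinner_commute[of x x], of Im] by simp
  then show ?thesis
    by (simp add: complex_eq_iff power2_norm_eq_inner inner_eq_Re_cinner)
qed

definition cscale :: "complex \<Rightarrow> ('i, 'w) l2 \<Rightarrow> ('i, 'w::complex_inner) l2"
  where "cscale c f = Abs_l2 (\<lambda>x. c *\<^sub>C coord f x)"

lemma coord_cscale [simp]: "coord (cscale c f) x = c *\<^sub>C coord f x"
  unfolding cscale_def
  by (subst coord_pointwise[where g="\<lambda>x w. c *\<^sub>C w" and C="cmod c"]) (simp_all add: norm_scaleC)

lemma vector_space_cscale: "vector_space (cscale :: complex \<Rightarrow> ('i, 'w) l2 \<Rightarrow> ('i, 'w::complex_inner) l2)"
  by unfold_locales (rule l2_eqI; simp add: scaleC_add_right scaleC_add_left scaleC_scaleC scaleC_one)+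

lemma cscale_of_real: "cscale (complex_of_real r) f = r *\<^sub>R f"
  by (rule l2_eqI) (simp add: scaleR_scaleC)

lemma norm_cscale: "norm (cscale c f) = cmod c * norm f"
proof -
  have "(norm (cscale c f))\<^sup>2 = (cmod c * norm f)\<^sup>2"
    by (simp add: norm_square_l2 norm_scaleC power_mult_distrib infsum_cmult_right')
  then show ?thesis by (simp add: power2_eq_iff_nonneg)
qed

lemma ell2_iff_range_coord: "f \<in> ell2 \<longleftrightarrow> f \<in> range coord"
  by (auto simp: ell2_def summable_coord intro: coord_Abs_l2[symmetric])

lemma ell2_inner_self: "ell2_inner (coord f) (coord f) = complex_of_real ((norm f)\<^sup>2)"
proof -
  have "((\<lambda>x. cinner (coord f x) (coord f x)) has_sum complex_of_real ((norm f)\<^sup>2)) UNIV"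
    unfolding cinner_self by (rule has_sum_bounded_linear[OF bounded_linear_of_real has_sum_norm_square_l2])
  then show ?thesis unfolding ell2_inner_def by (rule infsumI)
qed

lemma delta_tensor_eq: "delta_tensor x w = coord (single x w)"
  by (rule ext) (simp add: delta_tensor_def)

lemma translate_eq: "translate a (coord f) = coord (shift a f)"
  by (rule ext) (simp add: translate_def)

theorem corollary1p4:
  fixes U :: "(int ^ 'd \<Rightarrow> 'w::fin_dim_complex_hilbert) \<Rightarrow> (int ^ 'd \<Rightarrow> 'w)"
  assumes "periodic_unitary_transition_operator U"
  shows "((\<nexists>c. eigenvalue_ell2 U c) \<longleftrightarrow>
           (\<forall>u\<in>ell2. \<forall>x. limsup (\<lambda>n. ereal (transition_prob U n u x)) = 0)) \<and>
         ((\<nexists>c. eigenvalue_ell2 U c) \<longrightarrow>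
           \<not> (\<exists>u\<in>ell2. u \<noteq> (\<lambda>x. 0) \<and> (\<exists>x. localized_at U u x)))"
proof -
  have add: "U (\<lambda>x. f x + g x) = (\<lambda>x. U f x + U g x)" if "f \<in> ell2" "g \<in> ell2" for f g
    using assms that by (simp add: periodic_unitary_transition_operator_def unitary_ell2_def linear_ell2_def)
  have scale: "U (\<lambda>x. c *\<^sub>C f x) = (\<lambda>x. c *\<^sub>C U f x)" if "f \<in> ell2" for c f
    using assms that by (simp add: periodic_unitary_transition_operator_def unitary_ell2_def linear_ell2_def)
  have onto: "U ` ell2 = ell2"
    using assms by (simp add: periodic_unitary_transition_operator_def unitary_ell2_def)
  have isometry: "ell2_inner (U f) (U f) = ell2_inner f f" if "f \<in> ell2" for f
    using assms that by (simp add: periodic_unitary_transition_operator_def unitary_ell2_def)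
  have transl: "U (translate a f) = translate a (U f)" if "f \<in> ell2" for a f
    using assms that by (simp add: periodic_unitary_transition_operator_def)
  obtain S where S: "finite S" "\<And>x y \<phi>. y \<notin> (\<lambda>s. x + s) ` S \<Longrightarrow> U (delta_tensor x \<phi>) y = 0"
    using assms by (auto simp: periodic_unitary_transition_operator_def)
  have ell2: "coord f \<in> ell2" for f :: "(int ^ 'd, 'w) l2"
    by (simp add: ell2_iff_range_coord)
  define UH where "UH f = Abs_l2 (U (coord f))" for f
  have coord_UH: "coord (UH f) = U (coord f)" for f
  proof -
    have "U (coord f) \<in> ell2" using onto ell2 by blast
    then show ?thesis by (simp add: UH_def ell2_def coord_Abs_l2)
  qed
  have UH_add: "UH (f + g) = UH f + UH g" for f g
  proof (rule l2_eqI)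
    have "coord (f + g) = (\<lambda>x. coord f x + coord g x)" by auto
    then show "coord (UH (f + g)) x = coord (UH f + UH g) x" for x
      by (simp add: coord_UH add ell2)
  qed
  have UH_cscale: "UH (cscale c f) = cscale c (UH f)" for c f
  proof (rule l2_eqI)
    have "coord (cscale c f) = (\<lambda>x. c *\<^sub>C coord f x)" by auto
    then show "coord (UH (cscale c f)) x = coord (cscale c (UH f)) x" for x
      by (simp add: coord_UH scale ell2)
  qed
  have UH_scaleR: "UH (r *\<^sub>R f) = r *\<^sub>R UH f" for r f
    using UH_cscale[of "complex_of_real r" f] by (simp add: cscale_of_real)
  have lin: "linear UH" by (rule linearI) (simp_all add: UH_add UH_scaleR)
  have norm_UH: "norm (UH f) = norm f" for f
  proof -
    have "complex_of_real ((norm (UH f))\<^sup>2) = complex_of_real ((norm f)\<^sup>2)"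
      by (simp only: ell2_inner_self[symmetric] coord_UH isometry ell2)
    then have "(norm (UH f))\<^sup>2 = (norm f)\<^sup>2" by (simp only: of_real_eq_iff)
    then show ?thesis by (simp add: power2_eq_iff_nonneg)
  qed
  have inner_UH: "inner (UH f) (UH g) = inner f g" for f g
  proof -
    \<comment> \<open>Polarisation recovers the real inner product from preservation of the
      norm.\<close>
    have "inner v w = ((norm (v + w))\<^sup>2 - (norm (v - w))\<^sup>2) / 4" for v w :: "(int ^ 'd, 'w) l2"
      by (simp add: power2_norm_eq_inner inner_add_left inner_add_right inner_diff_left inner_diff_right inner_commute)
    then show ?thesis
      by (metis UH_add linear_diff[OF lin] norm_UH)
  qed
  have inj: "inj UH"
  proof (rule injI)
    fix f g assume "UH f = UH g"
    then have "norm (UH (f - g)) = 0" by (simp add: linear_diff[OF lin])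
    then show "f = g" by (simp add: norm_UH)
  qed
  have surj: "surj UH"
  \<comment> \<open>\<open>U\<close> is constrained only on \<open>ell2\<close>, so the preimage is
    chosen there.\<close>
  proof (rule surjI[of _ "\<lambda>g. Abs_l2 (inv_into ell2 U (coord g))"])
    fix g :: "(int ^ 'd, 'w) l2"
    have "coord g \<in> U ` ell2" using onto ell2 by simp
    then have "inv_into ell2 U (coord g) \<in> ell2" "U (inv_into ell2 U (coord g)) = coord g"
      by (simp_all add: inv_into_into f_inv_into_f)
    then show "UH (Abs_l2 (inv_into ell2 U (coord g))) = g"
      by (intro l2_eqI) (simp add: coord_UH coord_Abs_l2 ell2_def)
  qed
  define V where "V = inv UH"
  have UV: "UH (V f) = f" and VU: "V (UH f) = f" for f
    using surj inj by (simp_all add: V_def surj_f_inv_f)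
  have linV: "linear V"
    by (rule linearI) (metis UH_add UH_scaleR UV VU)+
  have normV: "norm (V f) = norm f" for f
    by (metis UV norm_UH)
  have blU: "bounded_linear UH" and blV: "bounded_linear V"
    by (rule bounded_linear_intro[where K=1];
        simp add: norm_UH normV linear_add[OF lin] linear_add[OF linV] linear_scale[OF lin] linear_scale[OF linV])+
  \<comment> \<open>The convolution kernel of the walk, read off from the images of vectors at the
    origin.\<close>
  define u where "u t = Blinfun (\<lambda>\<phi>. coord (UH (single 0 \<phi>)) t)" for t
  have u: "u t \<phi> = coord (UH (single 0 \<phi>)) t" for t \<phi>
  proof -
    have "bounded_linear (\<lambda>\<phi>. coord (UH (single 0 \<phi>)) t)"
    proof (rule bounded_linear_intro[where K=1])
      show "norm (coord (UH (single 0 \<phi>)) t) \<le> norm \<phi> * 1" for \<phi>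
        using norm_coord_le[of "UH (single 0 \<phi>)" t] by (simp add: norm_UH)
    qed (simp_all add: single_add single_scaleR UH_add UH_scaleR)
    then show ?thesis by (simp add: u_def bounded_linear_Blinfun_apply)
  qed
  have UH_single: "coord (UH (single y \<phi>)) x = (\<Sum>t\<in>S. u t (coord (single y \<phi>) (x - t)))" for x y \<phi>
  proof -
    have "U (coord (single y \<phi>)) = translate y (U (coord (single 0 \<phi>)))"
      using transl[OF ell2, of y "single 0 \<phi>"] by (simp add: translate_eq)
    then have eq: "coord (UH (single y \<phi>)) x = u (x - y) \<phi>"
      by (simp add: coord_UH u translate_def)
    have "(\<Sum>t\<in>S. u t (coord (single y \<phi>) (x - t))) = (\<Sum>t\<in>S. if x - y = t then u t \<phi> else 0)"
      by (intro sum.cong refl) (auto simp: algebra_simps)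
    also have "\<dots> = u (x - y) \<phi>"
      using S(1) S(2)[of "x - y" 0 \<phi>] by (auto simp: u delta_tensor_eq coord_UH)
    finally show ?thesis by (simp only: eq)
  qed
  have coord_U: "coord (UH f) x = (\<Sum>t\<in>S. u t (coord f (x - t)))" for f x
  proof -
    \<comment> \<open>The defect of the convolution formula is bounded in \<open>f\<close> and
      vanishes on one-site vectors, hence vanishes. The density lemma is applied to a sequence
      constant in \<open>n\<close>.\<close>
    define d where "d f = coord (UH f) x - (\<Sum>t\<in>S. u t (coord f (x - t)))" for f
    have norm_d: "norm (d f) \<le> (1 + (\<Sum>t\<in>S. norm (u t))) * norm f" for f
    proof -
      have "norm (u t (coord f (x - t))) \<le> norm (u t) * norm f" for t
        by (rule order_trans[OF norm_blinfun]) (intro mult_left_mono norm_coord_le norm_ge_zero)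
      then have "norm (\<Sum>t\<in>S. u t (coord f (x - t))) \<le> (\<Sum>t\<in>S. norm (u t)) * norm f"
        unfolding sum_distrib_right by (intro sum_norm_le)
      moreover have "norm (coord (UH f) x) \<le> norm f"
        using norm_coord_le[of "UH f" x] by (simp add: norm_UH)
      ultimately show ?thesis
        using norm_triangle_ineq4[of "coord (UH f) x" "\<Sum>t\<in>S. u t (coord f (x - t))"]
        by (simp add: d_def distrib_right)
    qed
    have bound: "\<bar>inner (d f) w\<bar> \<le> ((1 + (\<Sum>t\<in>S. norm (u t))) * norm w) * norm f" for f w
      using Cauchy_Schwarz_ineq2[of "d f" w] mult_right_mono[OF norm_d[of f], of "norm w"]
      by (simp add: mult_ac)
    have "(\<lambda>n :: nat. inner (d f) w) \<longlonglongrightarrow> 0" for w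
    proof (rule tendsto_0_if_singles[where \<phi>="\<lambda>n f. inner (d f) w"])
      show "linear (\<lambda>f. inner (d f) w)"
        by (intro linearI) (simp_all add: d_def UH_add UH_scaleR blinfun.add_right blinfun.scaleR_right
            sum.distrib inner_diff_left inner_add_left scaleR_sum_right[symmetric] right_diff_distrib)
      show "(\<lambda>n. inner (d (single y \<phi>)) w) \<longlonglongrightarrow> 0" for y \<phi>
        unfolding d_def UH_single by simp
    qed (rule bound)
    then have "inner (d f) (d f) = 0" by (simp add: LIMSEQ_const_iff)
    then show ?thesis by (simp add: d_def)
  qed
  obtain B :: "'w set" where "finite B" "span B = UNIV"
    using span_fin_dim_complex_hilbert by blast
  then obtain E :: "'w set" where E: "tight_frame E"
    using tight_frame_exists by blast
  have UHb: "blinfun_apply (Blinfun UH) = UH" and Vb: "blinfun_apply (Blinfun V) = V"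
    using blU blV by (simp_all add: bounded_linear_Blinfun_apply)
  interpret walk S u E "Blinfun UH" "Blinfun V"
    by unfold_locales (simp_all add: UHb Vb S(1) E coord_U UV VU inner_UH)
  have coord_pow: "coord ((UH ^^ n) f) = (U ^^ n) (coord f)" for n f
    by (induction n) (simp_all add: coord_UH)
  have limsup_0: "limsup (\<lambda>n. ereal (transition_prob U n f x)) = 0"
    if no_ev: "\<nexists>c. eigenvalue_ell2 U c" and f: "f \<in> ell2" for f x
  proof -
    have "still = {0}"
    proof (rule ccontr)
      assume "still \<noteq> {0}"
      then obtain h where h: "h \<in> still" "h \<noteq> 0"
        using subspace_0[OF subspace_still] by blast
      obtain q :: "real poly" where q: "q \<noteq> 0"
        "\<And>f. f \<in> still \<Longrightarrow> (\<Sum>k\<le>degree q. coeff q k *\<^sub>R (UH ^^ k) f) = 0"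
        by (rule still_polynomial_relation[unfolded UHb]) blast
      \<comment> \<open>The relation has real coefficients; it is read over the complex numbers so
        that it splits into linear factors.\<close>
      define p where "p = map_poly complex_of_real q"
      have "degree p = degree q" "p \<noteq> 0" "\<And>k. coeff p k = complex_of_real (coeff q k)"
        using q(1) by (simp_all add: p_def degree_map_poly map_poly_eq_0_iff coeff_map_poly)
      with q(2)[OF h(1)] have "(\<Sum>k\<le>degree p. cscale (coeff p k) ((UH ^^ k) h)) = 0"
        by (simp add: cscale_of_real)
      moreover have "Vector_Spaces.linear cscale cscale UH"
        using vector_space_cscale
        by (simp add: Vector_Spaces.linear_iff vector_space_pair_def UH_add UH_cscale)
      ultimately obtain a g where "g \<noteq> 0" "UH g = cscale a g"
        using complex_polynomial_relation_eigenvector[OF vector_space_cscale _ \<open>p \<noteq> 0\<close> h(2)] by blast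
      then have "U (coord g) = (\<lambda>x. a *\<^sub>C coord g x)" "coord g \<noteq> (\<lambda>x. 0)"
        using l2_eqI[of g 0] by (auto simp flip: coord_UH)
      then show False using no_ev ell2 by (auto simp: eigenvalue_ell2_def)
    qed
    moreover obtain g where "f = coord g" using f by (auto simp: ell2_iff_range_coord)
    ultimately have "(\<lambda>n. (U ^^ n) f x) \<longlonglongrightarrow> 0"
      using decay_if_still_trivial[of g x] by (simp add: UHb coord_pow)
    then have "(\<lambda>n. transition_prob U n f x) \<longlonglongrightarrow> 0"
      unfolding transition_prob_def by (auto intro!: tendsto_eq_intros)
    then have "(\<lambda>n. ereal (transition_prob U n f x)) \<longlonglongrightarrow> ereal 0"
      by (rule tendsto_ereal)
    from lim_imp_Limsup[OF _ this] show ?thesis by (simp add: zero_ereal_def)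
  qed
  moreover have "\<nexists>c. eigenvalue_ell2 U c"
    if *: "\<forall>u\<in>ell2. \<forall>x. limsup (\<lambda>n. ereal (transition_prob U n u x)) = 0"
  proof
    assume "\<exists>c. eigenvalue_ell2 U c"
    then obtain c f where f: "f \<in> ell2" "f \<noteq> (\<lambda>x. 0)" "U f = (\<lambda>x. c *\<^sub>C f x)"
      by (auto simp: eigenvalue_ell2_def)
    obtain g where g: "f = coord g" using f(1) by (auto simp: ell2_iff_range_coord)
    have Ug: "UH g = cscale c g"
      by (rule l2_eqI) (simp add: coord_UH f(3) flip: g)
    have "norm g \<noteq> 0" using f(2) g by auto
    \<comment> \<open>The eigenvalue has modulus 1, so the transition probabilities of the
      eigenvector are constant in time.\<close>
    then have c: "cmod c = 1"
      using norm_UH[of g] by (simp add: Ug norm_cscale)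
    interpret vector_space "cscale :: complex \<Rightarrow> (int ^ 'd, 'w) l2 \<Rightarrow> (int ^ 'd, 'w) l2"
      by (rule vector_space_cscale)
    have "(UH ^^ n) g = cscale (c ^ n) g" for n
      by (induction n) (simp_all add: UH_cscale Ug mult.commute)
    then have const: "transition_prob U n f x = (norm (f x))\<^sup>2" for n x
      by (simp add: transition_prob_def g norm_scaleC norm_power c flip: coord_pow)
    have "limsup (\<lambda>n. ereal (transition_prob U n f x)) = 0" for x
      using * f(1) by blast
    then have "f x = 0" for x by (simp add: const Limsup_const)
    with f(2) show False by auto
  qed
  moreover have "\<not> localized_at U f x" if "\<nexists>c. eigenvalue_ell2 U c" "f \<in> ell2" for f x
    using limsup_0[OF that] by (simp add: localized_at_def)
  ultimately show ?thesis by blast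
qed

end
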